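(* Let $n\in\mathbb{Z}_{\ge0}$ and $\mathrm{char}(\mathbb{F}_q)>3$. The counting function $\mathcal{N}^w(\mathbb{F}_q(t),B)$ (resp. $\mathcal{N}(\mathbb{F}_q(t),B)$), which gives the weighted count (resp. unweighted count) of the number of minimal elliptic curves over $\mathbb{P}^1_{\mathbb{F}_q}$ ordered by the multiplicative height of the discriminant $ht(\Delta)=q^{12n}\le B$, is given by $$\mathcal{N}^w(\mathbb{F}_q(t),B)=a_q\,B^{5/6}-B^{1/6},$$ $$\mathcal{N}(\mathbb{F}_q(t),B)=2a_q\,B^{5/6}+4b_q\,B^{1/2}+2c_q\,B^{1/3}-2B^{1/6}+d_q,$$ where $a_q,b_q,c_q,d_q\ge0$ are the explicit functions of $q$ $$a_q=\frac{q^9-1}{q^8-q^7},\quad b_q=\delta(6)\,\frac{q^5-1}{q^5-q^4},\quad c_q=\delta(4)\,\frac{q^3-1}{q^3-q^2},\quad d_q=4\delta(6)+2\delta(4),$$ with $\delta(x)=1$ if $x$ divides $q-1$ and $\delta(x)=0$ otherwise. The $B^{1/2}$ and $B^{1/3}$ terms come from counting $\mu_6$- and $\mu_4$-twist families, while the $B^{1/6}$ term comes from counting $\mu_2$-twist families concentrated at $j=\infty$.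
   Context: Every elliptic curve $E$ over $\mathbb{F}_q(t)$ ($\mathrm{char}>3$) has a unique integer $n\ge0$ and a globally minimal Weierstrass equation $y^2=x^3+a_4x+a_6$ over $\mathbb{P}^1_{\mathbb{F}_q}$ with $a_4\in H^0(\mathbb{P}^1,\mathcal{O}(4n))$, $a_6\in H^0(\mathbb{P}^1,\mathcal{O}(6n))$, where minimal means that at no geometric point of $\mathbb{P}^1$ do $a_4$ and $a_6$ vanish to order $\ge4$ and $\ge6$ respectively. The discriminant $\Delta$ is a section of $\mathcal{O}(12n)$, and the multiplicative height of the discriminant is $ht(\Delta)=q^{\deg\Delta}=q^{12n}$. Generically singular curves (the isotrivial ones with $j=\infty$) are not counted; isotrivial elliptic curves are. The unweighted count is the number of isomorphism classes, and the weighted count is the sum over the same isomorphism classes of $1/|\mathrm{Aut}(E)|$.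
   Formalization: The formulas are stated for B = q^{12n} with n ≥ 1: at n = 0 (B = 1) the weighted count is q rather than a_q − 1, and for B between consecutive values q^{12n} the counts stay constant while the right-hand sides vary, so the printed formulas fail there. *)

theory Defs
  imports "HOL-Algebra.Algebraic_Closure_Type" "HOL-Library.Extended_Nat" "HOL-Library.Cardinality" Complex_Main
begin

section \<open>Weierstrass curves over a field\<close>

text \<open>
  \<open>Weierstrass a1 a2 a3 a4 a6\<close> is the curve
  \<open>y\<^sup>2 + a1 x y + a3 y = x\<^sup>3 + a2 x\<^sup>2 + a4 x + a6\<close>; it is an elliptic curve (with origin
  the point at infinity) iff its discriminant is nonzero.
\<close>

datatype 'k weierstrass = Weierstrass 'k 'k 'k 'k 'k

fun discriminant :: "'k::field weierstrass \<Rightarrow> 'k" where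
  "discriminant (Weierstrass a1 a2 a3 a4 a6) =
     (let b2 = a1^2 + 4 * a2;
          b4 = 2 * a4 + a1 * a3;
          b6 = a3^2 + 4 * a6;
          b8 = a1^2 * a6 + 4 * a2 * a6 - a1 * a3 * a4 + a2 * a3^2 - a4^2
      in - (b2^2) * b8 - 8 * b4^3 - 27 * b6^2 + 9 * b2 * b4 * b6)"

fun c4_invariant :: "'k::field weierstrass \<Rightarrow> 'k" where
  "c4_invariant (Weierstrass a1 a2 a3 a4 a6) =
     (let b2 = a1^2 + 4 * a2; b4 = 2 * a4 + a1 * a3 in b2^2 - 24 * b4)"

definition j_invariant :: "'k::field weierstrass \<Rightarrow> 'k" where
  "j_invariant E = c4_invariant E ^ 3 / discriminant E"

definition is_elliptic :: "'k::field weierstrass \<Rightarrow> bool" where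
  "is_elliptic E \<longleftrightarrow> discriminant E \<noteq> 0"

text \<open>
  \<open>weierstrass_iso E E' (u, r, s, t)\<close>: the substitution \<open>x = u\<^sup>2 x' + r\<close>,
  \<open>y = u\<^sup>3 y' + s u\<^sup>2 x' + t\<close> with \<open>u \<noteq> 0\<close> turns the equation of \<open>E\<close> into \<open>u\<^sup>6\<close> times
  the equation of \<open>E'\<close>.  For elliptic curves these substitutions are exactly the
  isomorphisms over the base field that preserve the origin.
\<close>

fun weierstrass_iso ::
  "'k::field weierstrass \<Rightarrow> 'k weierstrass \<Rightarrow> 'k \<times> 'k \<times> 'k \<times> 'k \<Rightarrow> bool" where
  "weierstrass_iso (Weierstrass a1 a2 a3 a4 a6) (Weierstrass a1' a2' a3' a4' a6') (u, r, s, t)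
   \<longleftrightarrow> u \<noteq> 0
     \<and> u * a1' = a1 + 2 * s
     \<and> u^2 * a2' = a2 - s * a1 + 3 * r - s^2
     \<and> u^3 * a3' = a3 + r * a1 + 2 * t
     \<and> u^4 * a4' = a4 - s * a3 + 2 * r * a2 - (t + r * s) * a1 + 3 * r^2 - 2 * s * t
     \<and> u^6 * a6' = a6 + r * a4 + r^2 * a2 + r^3 - t * a3 - t^2 - r * t * a1"

definition isomorphism_relation :: "'k::field weierstrass rel" where
  "isomorphism_relation = {(E, E'). \<exists>\<phi>. weierstrass_iso E E' \<phi>}"

definition automorphisms :: "'k::field weierstrass \<Rightarrow> ('k \<times> 'k \<times> 'k \<times> 'k) set" where
  "automorphisms E = {\<phi>. weierstrass_iso E E \<phi>}"


section \<open>Minimal Weierstrass equations over the projective line\<close>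

datatype 'k proj_line = Finite_point 'k | Point_at_infinity

text \<open>
  A section of \<open>O(k)\<close> on the projective line over \<open>'a\<close> is encoded by its dehomogenisation,
  a polynomial in \<open>t\<close> of degree at most \<open>k\<close>.
\<close>

definition sections :: "nat \<Rightarrow> 'a::field poly set" where
  "sections k = {f. degree f \<le> k}"

text \<open>
  Order of vanishing of \<open>f\<close>, as a section of \<open>O(k)\<close>, at a geometric point.  At infinity it is
  \<open>k - degree f\<close> for \<open>f \<noteq> 0\<close>, which is why \<open>k\<close> is an argument.
\<close>

fun vanishing_order :: "nat \<Rightarrow> 'a::field poly \<Rightarrow> 'a alg_closure proj_line \<Rightarrow> enat" where
  "vanishing_order k f (Finite_point x) =
     (if f = 0 then \<infinity> else enat (Polynomial.order x (map_poly to_ac f)))"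
| "vanishing_order k f Point_at_infinity = (if f = 0 then \<infinity> else enat (k - degree f))"

definition minimal_weierstrass :: "nat \<Rightarrow> 'a::field poly \<Rightarrow> 'a poly \<Rightarrow> bool" where
  "minimal_weierstrass n a4 a6 \<longleftrightarrow>
     a4 \<in> sections (4 * n) \<and> a6 \<in> sections (6 * n) \<and>
     (\<forall>P. \<not> (vanishing_order (4 * n) a4 P \<ge> 4 \<and> vanishing_order (6 * n) a6 P \<ge> 6))"

definition generic_fibre :: "'a::field poly \<Rightarrow> 'a poly \<Rightarrow> 'a poly fract weierstrass" where
  "generic_fibre a4 a6 = Weierstrass 0 0 0 (to_fract a4) (to_fract a6)"

definition minimal_model ::
  "'a::field poly fract weierstrass \<Rightarrow> nat \<Rightarrow> 'a poly \<Rightarrow> 'a poly \<Rightarrow> bool" where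
  "minimal_model E n a4 a6 \<longleftrightarrow>
     minimal_weierstrass n a4 a6 \<and> (E, generic_fibre a4 a6) \<in> isomorphism_relation"


section \<open>Counting functions\<close>

text \<open>
  The discriminant of a minimal equation \<open>(n, a4, a6)\<close> is a section of \<open>O(12 n)\<close>, so its
  multiplicative height is \<open>q^(12 n)\<close> with \<open>q\<close> the size of the finite base field.  The set
  below also contains the generically singular curves (those with \<open>j = \<infinity>\<close>).

  Every curve of the set has height \<open>q^(12 m)\<close> for some \<open>m \<ge> 0\<close>, so the counting functions are
  step functions, and closed formulas in \<open>B\<close> are meaningful only at \<open>B = q^(12 n)\<close>.  At
  \<open>n = 0\<close> (constant curves only) the unweighted count is \<open>2 q + 4 \<delta>(6) + 2 \<delta>(4)\<close>, which
  differs from the general formula; that one needs \<open>n \<ge> 1\<close>.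
\<close>

definition weierstrass_upto :: "real \<Rightarrow> 'a::{field,finite} poly fract weierstrass set" where
  "weierstrass_upto B =
     {E. \<exists>n a4 a6. minimal_model E n a4 a6 \<and> real (CARD('a) ^ (12 * n)) \<le> B}"

definition elliptic_upto :: "real \<Rightarrow> 'a::{field,finite} poly fract weierstrass set" where
  "elliptic_upto B = {E \<in> weierstrass_upto B. is_elliptic E}"

definition singular_upto :: "real \<Rightarrow> 'a::{field,finite} poly fract weierstrass set" where
  "singular_upto B = {E \<in> weierstrass_upto B. \<not> is_elliptic E}"

definition elliptic_upto_with_j ::
  "'a::{field,finite} poly fract \<Rightarrow> real \<Rightarrow> 'a poly fract weierstrass set" where
  "elliptic_upto_with_j j B = {E \<in> elliptic_upto B. j_invariant E = j}"

definition unweighted_count :: "'k::field weierstrass set \<Rightarrow> nat" where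
  "unweighted_count S = card (S // isomorphism_relation)"

definition weighted_count :: "'k::field weierstrass set \<Rightarrow> real" where
  "weighted_count S =
     (\<Sum>C \<in> S // isomorphism_relation. 1 / real (card (automorphisms (SOME E. E \<in> C))))"


section \<open>The explicit functions of \<open>q\<close>\<close>

definition delta :: "nat \<Rightarrow> nat \<Rightarrow> real" where
  "delta x q = (if x dvd q - 1 then 1 else 0)"

definition coeff_a :: "nat \<Rightarrow> real" where
  "coeff_a q = (real q ^ 9 - 1) / (real q ^ 8 - real q ^ 7)"

definition coeff_b :: "nat \<Rightarrow> real" where
  "coeff_b q = delta 6 q * ((real q ^ 5 - 1) / (real q ^ 5 - real q ^ 4))"

definition coeff_c :: "nat \<Rightarrow> real" where
  "coeff_c q = delta 4 q * ((real q ^ 3 - 1) / (real q ^ 3 - real q ^ 2))"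

definition coeff_d :: "nat \<Rightarrow> real" where
  "coeff_d q = 4 * delta 6 q + 2 * delta 4 q"

end

theory Submission
  imports Defs
begin

text \<open>
  Away from characteristic 2 and 3 every isomorphism between equations \<open>y\<^sup>2 = x\<^sup>3 + a x + b\<close> is a
  scaling of \<open>(a, b)\<close> by \<open>(u\<^sup>4, u\<^sup>6)\<close>, and between minimal equations \<open>u\<close> must be constant
  (\<open>curve_of_iso_iff\<close>).  Call \<open>(a, b)\<close> primitive if no nonconstant \<open>g\<close> satisfies \<open>g\<^sup>4 dvd a\<close> and
  \<open>g\<^sup>6 dvd b\<close>.  Primitivity is minimality at the finite points, while minimality at infinity merely
  singles out the least \<open>k\<close> with \<open>degree a \<le> 4 k\<close> and \<open>degree b \<le> 6 k\<close> (\<open>ex_minimal_weierstrass_iff\<close>).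
  So the curves of height at most \<open>q\<^bsup>12 n\<^esup>\<close> are the orbits of the \<open>q - 1\<close> nonzero constants on the
  primitive pairs of degrees at most \<open>4 n\<close> and \<open>6 n\<close>, and the automorphism group of a curve is the
  stabiliser of its pair.  By the orbit-stabiliser theorem the weighted count is the number of these
  pairs divided by \<open>q - 1\<close>, and the unweighted count is the sum of the orders of their stabilisers
  divided by \<open>q - 1\<close> (\<open>counts_of_curves_of\<close>).

  Primitive pairs are counted by a sieve.  Every nonzero pair is uniquely \<open>(g\<^sup>4 a, g\<^sup>6 b)\<close> with \<open>g\<close>
  monic and \<open>(a, b)\<close> primitive.  Let \<open>N n\<close> and \<open>P n\<close> be the numbers of nonzero and of primitive pairs
  within the degree bounds for \<open>n\<close>, in a family that is stable under scaling; then \<open>N n\<close> is the sum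
  of \<open>P (n - degree g)\<close> over the monic \<open>g\<close> of degree at most \<open>n\<close>.  The nonconstant ones among them
  are \<open>T h + c\<close> with \<open>h\<close> monic, so the sum telescopes to \<open>N (n + 1) = P (n + 1) + q N n\<close>
  (\<open>card_primitive_pairs_Suc\<close>).  In the families considered \<open>N n\<close> is \<open>q\<^bsup>e n + f\<^esup> - 1\<close>, where \<open>(e, f)\<close>
  is \<open>(10, 2)\<close> for all pairs, \<open>(6, 1)\<close> for \<open>a = 0\<close>, \<open>(4, 1)\<close> for \<open>b = 0\<close>, and \<open>(2, 1)\<close> for the singular
  pairs \<open>(-3 c\<^sup>2, 2 c\<^sup>3)\<close>.

  Stabilisers are \<open>\<mu>\<^sub>2\<close>, except for \<open>\<mu>\<^sub>6\<close> on the family \<open>a = 0\<close>, where \<open>j = 0\<close>, and \<open>\<mu>\<^sub>4\<close> on the family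
  \<open>b = 0\<close>, where \<open>j = 1728\<close>.  The unweighted count is therefore twice the weighted one plus a
  correction from each of these two families if the additional roots of unity lie in the base field.

  Minimality is a condition at geometric points.  It can be tested with polynomials over the base
  field because a finite field is perfect: minimal polynomials have simple roots
  (\<open>order_minimal_polynomial\<close>).
\<close>

section \<open>Minimal polynomials and prime factors\<close>

lemma to_ac_poly_mult [simp]:
  "map_poly to_ac (p * q) = map_poly to_ac p * map_poly to_ac (q :: 'a::field poly)"
  by (rule poly_eqI) (simp add: coeff_map_poly coeff_mult to_ac_sum)

lemma to_ac_poly_diff [simp]:
  "map_poly to_ac (p - q) = map_poly to_ac p - map_poly to_ac (q :: 'a::field poly)"
  by (rule poly_eqI) (simp add: coeff_map_poly)

lemma to_ac_poly_eq_0_iff [simp]: "map_poly to_ac (p :: 'a::field poly) = 0 \<longleftrightarrow> p = 0"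
  by (simp add: map_poly_eq_0_iff)

lemma degree_to_ac_poly [simp]: "degree (map_poly to_ac (p :: 'a::field poly)) = degree p"
  by (simp add: degree_map_poly)

abbreviation root_of :: "'a::field poly \<Rightarrow> 'a alg_closure \<Rightarrow> bool" where
  "root_of f x \<equiv> poly (map_poly to_ac f) x = 0"

lemma ex_root:
  fixes f :: "'a::field poly"
  assumes "degree f > 0"
  shows "\<exists>x. root_of f x"
  using alg_closed_imp_poly_has_root[of "map_poly to_ac f"] assms by simp

text \<open>
  Not normalised to be monic: only the ideal of polynomials that vanish at \<open>x\<close> matters.
\<close>
definition is_minimal_polynomial :: "'a::field poly \<Rightarrow> 'a alg_closure \<Rightarrow> bool" where
  "is_minimal_polynomial m x \<longleftrightarrow> m \<noteq> 0 \<and> (\<forall>f. root_of f x \<longleftrightarrow> m dvd f)"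

lemma minimal_polynomial_exists:
  fixes x :: "'a::field alg_closure"
  shows "\<exists>m. is_minimal_polynomial m x"
proof -
  define Q where "Q = (\<lambda>f. f \<noteq> 0 \<and> root_of f x)"
  obtain f0 where "Q f0" using alg_closure_algebraic[of x] unfolding Q_def by blast
  then obtain m where m: "Q m" and least: "\<And>f. Q f \<Longrightarrow> degree m \<le> degree f"
    using ex_has_least_nat[of Q f0 degree] by blast
  have "m dvd f" if "root_of f x" for f
  proof -
    have "root_of (f mod m) x"
      using that m unfolding Q_def by (simp add: minus_div_mult_eq_mod[symmetric])
    then have "f mod m = 0"
      using least[of "f mod m"] m degree_mod_less'[of m f] unfolding Q_def by fastforce
    then show ?thesis by (simp add: mod_eq_0_iff_dvd)
  qed
  moreover have "root_of f x" if "m dvd f" for f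
    using that m unfolding Q_def by (auto elim!: dvdE)
  ultimately show ?thesis using m unfolding is_minimal_polynomial_def Q_def by blast
qed

lemma is_minimal_polynomialD:
  assumes "is_minimal_polynomial m x"
  shows "m \<noteq> 0" "root_of f x \<longleftrightarrow> m dvd f"
  using assms unfolding is_minimal_polynomial_def by blast+

text \<open>
  The polynomials that vanish at \<open>x\<close> form a prime ideal.  Through this lemma every
  prime element that the divisibility arguments below need is obtained as the minimal polynomial of
  a root.
\<close>
lemma prime_elem_minimal_polynomial:
  assumes "is_minimal_polynomial m x"
  shows "prime_elem m"
proof (rule prime_elemI)
  note D = is_minimal_polynomialD[OF assms]
  show "m \<noteq> 0" by (fact D)
  have "\<not> root_of 1 x" by simp
  then show "\<not> m dvd 1" using D(2) by blast
  show "m dvd f \<or> m dvd g" if "m dvd f * g" for f g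
    using that D(2)[symmetric] by simp
qed

lemma ex_prime_dvd:
  fixes f :: "'a::field poly"
  assumes "degree f > 0"
  shows "\<exists>p. prime_elem p \<and> p dvd f"
proof -
  obtain x where "root_of f x" using ex_root[OF assms] by blast
  moreover obtain m where "is_minimal_polynomial m x" using minimal_polynomial_exists by blast
  ultimately show ?thesis
    using prime_elem_minimal_polynomial is_minimal_polynomialD(2) by blast
qed

lemma prime_elem_degree_pos:
  fixes p :: "'a::field poly"
  assumes "prime_elem p"
  shows "degree p > 0"
  using assms is_unit_iff_degree prime_elem_def by blast

lemma prime_elem_power_dvd_cancel:
  fixes p :: "'a::field poly"
  assumes "prime_elem p" "\<not> p dvd h" "p ^ k dvd h ^ m * f"
  shows "p ^ k dvd f"
proof -
  obtain i j where ij: "i + j = k" "p ^ i dvd h ^ m" "p ^ j dvd f"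
    using prime_elem_power_dvd_prod[OF assms(3,1)] by blast
  have "i = 0"
  proof (rule ccontr)
    assume "i \<noteq> 0"
    then have "p dvd h ^ m" using ij(2) dvd_power[of i p] dvd_trans by blast
    then show False using prime_elem_dvd_power assms by blast
  qed
  then show ?thesis using ij by simp
qed

section \<open>Unique factorisation of coefficient pairs\<close>

text \<open>
  Minimality of \<open>y\<^sup>2 = x\<^sup>3 + a x + b\<close> at the finite points of the projective line, stated inside
  the polynomial ring.  At \<open>g = 0\<close> it excludes the pair \<open>(0, 0)\<close>.
\<close>
definition primitive :: "'a::field poly \<times> 'a poly \<Rightarrow> bool" where
  "primitive = (\<lambda>(a, b). \<forall>g. g ^ 4 dvd a \<and> g ^ 6 dvd b \<longrightarrow> is_unit g)"

lemma not_primitive_0 [simp]: "\<not> primitive (0, 0 :: 'a::field poly)"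
  unfolding primitive_def by (auto intro!: exI[of _ 0])

text \<open>
  The effect on the coefficients of \<open>y\<^sup>2 = x\<^sup>3 + a x + b\<close> of rescaling \<open>x\<close> by \<open>g\<^sup>2\<close> and \<open>y\<close> by \<open>g\<^sup>3\<close>.
\<close>
definition scale :: "'a::comm_semiring_1 \<Rightarrow> 'a \<times> 'a \<Rightarrow> 'a \<times> 'a" where
  "scale g = (\<lambda>(a, b). (g ^ 4 * a, g ^ 6 * b))"

lemma scale_scale: "scale g (scale h p) = scale (g * h) p"
  by (simp add: scale_def case_prod_unfold power_mult_distrib mult.assoc)

lemma scale_1 [simp]: "scale 1 p = p"
  by (simp add: scale_def case_prod_unfold)

lemma scale_cancel:
  fixes g :: "'a::field poly"
  shows "g \<noteq> 0 \<Longrightarrow> scale g p = scale g r \<longleftrightarrow> p = r"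
  by (auto simp: scale_def case_prod_unfold prod_eq_iff)

lemma scale_eq_0_iff:
  fixes g :: "'a::field poly"
  shows "g \<noteq> 0 \<Longrightarrow> scale g p = (0, 0) \<longleftrightarrow> p = (0, 0)"
  by (auto simp: scale_def case_prod_unfold prod_eq_iff)

text \<open>
  Two primitive pairs that agree up to scaling differ by a constant.  If a prime \<open>s\<close> divides \<open>g\<close> but
  not \<open>h\<close>, then \<open>s\<^sup>4\<close> and \<open>s\<^sup>6\<close> must divide the two entries of \<open>r\<close>, against its primitivity; so every
  prime factor of \<open>g\<close> is one of \<open>h\<close> and conversely, and it can be cancelled.  This lemma is used
  twice: for the uniqueness of the factorisation that drives the count, and to see that an
  isomorphism between minimal equations over the function field is given by a constant.
\<close>
lemma primitive_scale_unique:
  fixes g h :: "'a::field poly"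
  assumes "primitive p" "primitive r" "g \<noteq> 0" "h \<noteq> 0" "scale g p = scale h r"
  shows "\<exists>c. c \<noteq> 0 \<and> h = smult c g"
  using assms(3-)
proof (induction "degree g + degree h" arbitrary: g h rule: less_induct)
  case less
  show ?case
  proof (cases "degree g = 0 \<and> degree h = 0")
    case True
    then obtain c d where "g = [:c:]" "h = [:d:]" by (meson degree_eq_zeroE)
    then show ?thesis using less.prems by (intro exI[of _ "d / c"]) auto
  next
    case False
    then have "degree g > 0 \<or> degree h > 0" by simp
    then obtain s where s: "prime_elem s" "s dvd g \<or> s dvd h" using ex_prime_dvd by metis
    \<comment> \<open>Stated for general pairs because it is applied once in each direction.\<close>
    have key: "s dvd h'"
      if "primitive p'" "primitive r'" "scale g' p' = scale h' r'" "s dvd g'" for g' h' p' r'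
    proof (rule ccontr)
      assume nd: "\<not> s dvd h'"
      have "g' ^ 4 * fst p' = h' ^ 4 * fst r'" "g' ^ 6 * snd p' = h' ^ 6 * snd r'"
        using that(3) by (simp_all add: scale_def case_prod_unfold)
      then have "s ^ 4 dvd h' ^ 4 * fst r'" "s ^ 6 dvd h' ^ 6 * snd r'"
        using dvd_power_same[OF \<open>s dvd g'\<close>] by (metis dvd_mult2)+
      then have "s ^ 4 dvd fst r'" "s ^ 6 dvd snd r'"
        using prime_elem_power_dvd_cancel[OF s(1) nd] by blast+
      then have "is_unit s" using that(2) unfolding primitive_def by (auto simp: case_prod_unfold)
      then show False using s(1) by (simp add: prime_elem_def)
    qed
    have "s dvd g" "s dvd h"
      using s(2) key[OF assms(1,2) less.prems(3)] key[OF assms(2,1) less.prems(3)[symmetric]] by blast+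
    then obtain g' h' where gh: "g = s * g'" "h = s * h'" by (auto elim!: dvdE)
    then have "scale s (scale g' p) = scale s (scale h' r)"
      using less.prems(3) by (simp add: scale_scale)
    then have "scale g' p = scale h' r" using s(1) scale_cancel by (metis prime_elem_not_zeroI)
    moreover have "g' \<noteq> 0" "h' \<noteq> 0" "s \<noteq> 0" using less.prems gh by auto
    moreover from this have "degree g' + degree h' < degree g + degree h"
      using prime_elem_degree_pos[OF s(1)] gh by (simp add: degree_mult_eq)
    ultimately obtain c where "c \<noteq> 0" "h' = smult c g'" using less.hyps by blast
    then show ?thesis using gh by auto
  qed
qed

lemma monic_primitive_scale_unique:
  fixes g h :: "'a::field poly"
  assumes "primitive p" "primitive r" "lead_coeff g = 1" "lead_coeff h = 1" "scale g p = scale h r"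
  shows "g = h \<and> p = r"
proof -
  have "g \<noteq> 0" "h \<noteq> 0" using assms by auto
  then obtain c where "c \<noteq> 0" "h = smult c g" using primitive_scale_unique assms by blast
  then have "g = h" using assms(3,4) by simp
  then show ?thesis using assms(5) \<open>g \<noteq> 0\<close> scale_cancel by blast
qed

text \<open>
  As long as the pair is not primitive, a nonconstant monic factor can be split off, and the degrees
  drop.
\<close>
lemma ex_primitive_scale:
  fixes p :: "'a::field poly \<times> 'a poly"
  assumes "p \<noteq> (0, 0)"
  shows "\<exists>g r. lead_coeff g = 1 \<and> primitive r \<and> p = scale g r"
  using assms
proof (induction "degree (fst p) + degree (snd p)" arbitrary: p rule: less_induct)
  case less
  show ?case
  proof (cases "primitive p")
    case True
    then show ?thesis by (intro exI[of _ 1] exI[of _ p]) simp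
  next
    case False
    then obtain g where g: "g ^ 4 dvd fst p" "g ^ 6 dvd snd p" "\<not> is_unit g"
      unfolding primitive_def by (auto simp: case_prod_unfold)
    have "g \<noteq> 0"
      using g less.prems by (metis dvd_0_left power_eq_0_iff prod.collapse zero_less_numeral)
    then have deg: "degree g > 0" using g(3) is_unit_iff_degree by blast
    define h where "h = smult (inverse (lead_coeff g)) g"
    have h: "lead_coeff h = 1" "degree h > 0" "h \<noteq> 0" using deg \<open>g \<noteq> 0\<close> unfolding h_def by auto
    have "h ^ 4 dvd fst p" "h ^ 6 dvd snd p"
      using g \<open>g \<noteq> 0\<close> unfolding h_def by (simp_all add: smult_power smult_dvd_iff)
    then obtain a b where "fst p = h ^ 4 * a" "snd p = h ^ 6 * b" by (auto elim!: dvdE)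
    then have p: "p = scale h (a, b)" by (simp add: scale_def prod_eq_iff)
    then have nz: "(a, b) \<noteq> (0, 0)" using less.prems h(3) by (auto simp: scale_def)
    have "degree a + degree b < degree (fst p) + degree (snd p)"
      using nz h by (cases "a = 0"; cases "b = 0")
        (auto simp: p scale_def degree_mult_eq degree_power_eq)
    then obtain k r where "lead_coeff k = 1" "primitive r" "(a, b) = scale k r"
      using less.hyps[of "(a, b)"] nz by auto
    then show ?thesis
      using p h(1) by (intro exI[of _ "h * k"] exI[of _ r]) (auto simp: scale_scale lead_coeff_mult)
  qed
qed

section \<open>Geometric points and primitive pairs\<close>

lemma inj_pCons: "inj (\<lambda>(c, f :: 'a::zero poly). pCons c f)"
  by (auto simp: inj_on_def)

lemma card_poly_degree_le:
  "card {f :: 'a::{zero,finite} poly. degree f \<le> k} = CARD('a) ^ Suc k"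
proof (induction k)
  case 0
  have "{f :: 'a poly. degree f \<le> 0} = range (\<lambda>c. [:c:])"
    by (auto elim!: degree_eq_zeroE)
  then show ?case by (simp add: card_image inj_on_def)
next
  case (Suc k)
  have "{f :: 'a poly. degree f \<le> Suc k} = (\<lambda>(c, f). pCons c f) ` (UNIV \<times> {f. degree f \<le> k})"
  proof (intro equalityI subsetI)
    fix f :: "'a poly" assume "f \<in> {f. degree f \<le> Suc k}"
    then show "f \<in> (\<lambda>(c, f). pCons c f) ` (UNIV \<times> {f. degree f \<le> k})"
      by (cases f) (auto split: if_splits)
  qed auto
  then show ?case
    using Suc by (simp add: card_image inj_on_subset[OF inj_pCons] card_cartesian_product)
qed

lemma finite_poly_degree_le: "finite {f :: 'a::{zero,finite} poly. degree f \<le> k}"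
  by (rule card_ge_0_finite) (simp add: card_poly_degree_le)

text \<open>
  The powers of \<open>x\<close> are values at \<open>x\<close> of remainders modulo its minimal polynomial, of which there
  are finitely many; so two powers of \<open>x\<close> coincide.
\<close>
lemma alg_closure_finite_field_root_of_unity:
  fixes x :: "'a::{field,finite} alg_closure"
  assumes "x \<noteq> 0"
  shows "\<exists>k>0. x ^ k = 1"
proof -
  obtain m where m: "is_minimal_polynomial m x" using minimal_polynomial_exists by blast
  define f where "f = (\<lambda>i. monom 1 i mod m)"
  have "finite (range f)"
  proof (rule finite_subset)
    have "degree (f i) \<le> degree m" for i
      unfolding f_def using degree_mod_less[OF is_minimal_polynomialD(1)[OF m], of "monom 1 i"] by auto
    then show "range f \<subseteq> {g. degree g \<le> degree m}" by auto
  qed (rule finite_poly_degree_le)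
  then have "\<not> inj f" using finite_imageD by fastforce
  then obtain i j where ij: "i < j" "f i = f j"
    by (auto simp: inj_on_def neq_iff)
  have ev: "poly (map_poly to_ac (f i)) x = x ^ i" for i
  proof -
    have "map_poly to_ac (f i) = monom 1 i - map_poly to_ac (monom 1 i div m) * map_poly to_ac m"
      unfolding f_def by (simp add: minus_div_mult_eq_mod[symmetric] map_poly_monom)
    then show ?thesis using is_minimal_polynomialD(2)[OF m, of m] by (simp add: poly_monom)
  qed
  have "x ^ i * x ^ (j - i) = x ^ j" using ij(1) by (simp add: power_add[symmetric])
  also have "\<dots> = x ^ i * 1" using ev[of i] ev[of j] ij by simp
  finally have "x ^ (j - i) = 1" using assms by simp
  then show ?thesis using ij(1) by (intro exI[of _ "j - i"]) simp
qed

text \<open>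
  The least exponent \<open>k\<close> works: if the characteristic \<open>p\<close> divided \<open>k = p l\<close>, then
  \<open>(x\<^sup>l - 1)\<^sup>p = x\<^sup>k - 1 = 0\<close>, so already \<open>x\<^sup>l = 1\<close>.
\<close>
lemma alg_closure_finite_field_separable_root_of_unity:
  fixes x :: "'a::{field,finite} alg_closure"
  assumes "x \<noteq> 0"
  shows "\<exists>k>0. x ^ k = 1 \<and> (of_nat k :: 'a alg_closure) \<noteq> 0"
proof -
  let ?p = "CHAR('a alg_closure)"
  have p: "prime ?p"
    using prime_CHAR_semidom[where ?'a = 'a] finite_imp_CHAR_pos[where ?'a = 'a] by simp
  define Q where "Q k \<longleftrightarrow> k > 0 \<and> x ^ k = 1" for k
  define k where "k = (LEAST k. Q k)"
  have ex: "\<exists>k. Q k" using alg_closure_finite_field_root_of_unity[OF assms] unfolding Q_def by blast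
  then have k: "Q k" unfolding k_def by (rule LeastI_ex)
  have "of_nat k \<noteq> (0 :: 'a alg_closure)"
  proof
    assume "of_nat k = (0 :: 'a alg_closure)"
    then obtain l where l: "k = ?p * l" using of_nat_eq_0_iff_char_dvd[where ?'a = "'a alg_closure"] by (auto elim!: dvdE)
    \<comment> \<open>The additive form of the freshman's dream, applied to \<open>x\<^sup>l - 1\<close> and \<open>1\<close>.\<close>
    have "(x ^ l - 1) ^ ?p + 1 = (x ^ l - 1 + 1) ^ ?p"
      using freshmans_dream[OF p refl, of "x ^ l - 1" 1] by simp
    also have "\<dots> = 1" using k l by (simp add: Q_def power_mult[symmetric] mult.commute)
    finally have "x ^ l = 1" by simp
    then have "Q l" using k l unfolding Q_def by (intro conjI) (auto intro: gr0I)
    then have "k \<le> l" unfolding k_def by (rule Least_le)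
    moreover have "l * 1 < l * ?p" using prime_gt_1_nat[OF p] k l unfolding Q_def
      by (intro mult_strict_left_mono) auto
    ultimately show False using l by (simp add: mult.commute)
  qed
  then show ?thesis using k unfolding Q_def by blast
qed

text \<open>
  Finite fields are perfect: an element of the closure is a simple root of its minimal polynomial.
  For \<open>x \<noteq> 0\<close> that polynomial divides some \<open>T\<^sup>k - 1\<close> with \<open>k\<close> prime to the characteristic, whose
  derivative \<open>k T\<^bsup>k-1\<^esup>\<close> does not vanish at \<open>x\<close>.
\<close>
lemma order_minimal_polynomial:
  fixes x :: "'a::{field,finite} alg_closure"
  assumes "is_minimal_polynomial m x"
  shows "Polynomial.order x (map_poly to_ac m) = 1"
proof -
  have m0: "m \<noteq> 0" and rt: "root_of f x \<longleftrightarrow> m dvd f" for f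
    using is_minimal_polynomialD[OF assms] by blast+
  have "\<exists>f. m dvd f \<and> f \<noteq> 0 \<and> Polynomial.order x (map_poly to_ac f) \<le> 1"
  proof (cases "x = 0")
    case True
    have "root_of [:0, 1:] x" using True by (simp add: map_poly_pCons)
    then show ?thesis using rt[of "[:0, 1:]"] True order_degree[of "map_poly to_ac [:0, 1::'a:]" x]
      by (intro exI[of _ "[:0, 1:]"]) (simp del: degree_to_ac_poly add: map_poly_pCons)
  next
    case False
    then obtain k where k: "k > 0" "x ^ k = 1" "(of_nat k :: 'a alg_closure) \<noteq> 0"
      using alg_closure_finite_field_separable_root_of_unity by blast
    define f :: "'a poly" where "f = monom 1 k - 1"
    have L: "map_poly to_ac f = monom 1 k - 1" unfolding f_def by (simp add: map_poly_monom)
    have "coeff f k = 1" using k(1) unfolding f_def by simp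
    then have "f \<noteq> 0" by auto
    moreover have "m dvd f" using rt[of f] k(2) L by (simp add: poly_monom)
    moreover have "Polynomial.order x (map_poly to_ac f) \<le> 1"
    proof (rule ccontr)
      assume "\<not> Polynomial.order x (map_poly to_ac f) \<le> 1"
      then have "[:-x, 1:] ^ 2 dvd map_poly to_ac f" by (subst order_divides) simp
      then obtain h where "map_poly to_ac f = [:-x, 1:] ^ 2 * h" by (elim dvdE)
      then have "poly (pderiv (map_poly to_ac f)) x = 0"
        by (simp add: pderiv_mult pderiv_power del: mult_pCons_left)
      then show False using k False unfolding L by (simp add: pderiv_diff pderiv_monom poly_monom)
    qed
    ultimately show ?thesis by blast
  qed
  then obtain f where "m dvd f" "f \<noteq> 0" "Polynomial.order x (map_poly to_ac f) \<le> 1" by blast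
  moreover from this have "map_poly to_ac m dvd map_poly to_ac f" by (auto elim!: dvdE)
  ultimately have "Polynomial.order x (map_poly to_ac m) \<le> 1"
    using dvd_imp_order_le[of "map_poly to_ac f" "map_poly to_ac m" x] by simp
  moreover have "Polynomial.order x (map_poly to_ac m) \<noteq> 0"
    using rt[of m] m0 by (simp add: order_root)
  ultimately show ?thesis by simp
qed

text \<open>
  Because the root is simple, each factor \<open>m\<close> contributes exactly one to the order of vanishing at
  \<open>x\<close>.  This is what allows geometric points to be replaced by prime polynomials over the base
  field; over an imperfect field it would fail.
\<close>
lemma order_ge_iff_minimal_polynomial_power_dvd:
  fixes x :: "'a::{field,finite} alg_closure"
  assumes m: "is_minimal_polynomial m x" and "f \<noteq> 0"
  shows "k \<le> Polynomial.order x (map_poly to_ac f) \<longleftrightarrow> m ^ k dvd f"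
  using assms(2)
proof (induction k arbitrary: f)
  case (Suc k)
  have step: "Polynomial.order x (map_poly to_ac (m * h)) = Suc (Polynomial.order x (map_poly to_ac h))"
    if "h \<noteq> 0" for h
    using that is_minimal_polynomialD(1)[OF m]
    by (simp add: order_mult order_minimal_polynomial[OF m])
  show ?case
  proof (cases "m dvd f")
    case True
    then obtain h where "f = m * h" by (elim dvdE)
    then show ?thesis using Suc step is_minimal_polynomialD(1)[OF m] by auto
  next
    case False
    then have "Polynomial.order x (map_poly to_ac f) = 0"
      using is_minimal_polynomialD(2)[OF m] by (simp add: order_0I)
    then show ?thesis using False by (metis dvd_mult_left not_less_eq_eq power_Suc zero_le)
  qed
qed simp

lemma vanishing_order_finite_ge_iff:
  fixes x :: "'a::{field,finite} alg_closure"
  assumes "is_minimal_polynomial m x"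
  shows "enat k \<le> vanishing_order d f (Finite_point x) \<longleftrightarrow> m ^ k dvd f"
  using order_ge_iff_minimal_polynomial_power_dvd[OF assms] by simp

lemma vanishing_order_infinity_ge_iff:
  "enat k \<le> vanishing_order d f Point_at_infinity \<longleftrightarrow> f = 0 \<or> k + degree f \<le> d \<or> k = 0"
  by auto

lemma primitive_iff_finite_points:
  fixes a b :: "'a::{field,finite} poly"
  shows "primitive (a, b) \<longleftrightarrow>
    (\<forall>x. \<not> (4 \<le> vanishing_order d a (Finite_point x) \<and> 6 \<le> vanishing_order e b (Finite_point x)))"
    (is "_ \<longleftrightarrow> ?R")
proof
  assume P: "primitive (a, b)"
  show ?R
  proof (intro allI notI)
    fix x assume *: "4 \<le> vanishing_order d a (Finite_point x) \<and> 6 \<le> vanishing_order e b (Finite_point x)"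
    obtain m where m: "is_minimal_polynomial m x" using minimal_polynomial_exists by blast
    have "m ^ 4 dvd a" "m ^ 6 dvd b"
      using * vanishing_order_finite_ge_iff[OF m, of 4] vanishing_order_finite_ge_iff[OF m, of 6]
      by (simp_all add: numeral_eq_enat del: vanishing_order.simps)
    then have "is_unit m" using P unfolding primitive_def by auto
    then show False using prime_elem_minimal_polynomial[OF m] by (simp add: prime_elem_def)
  qed
next
  assume R: ?R
  show "primitive (a, b)"
    unfolding primitive_def
  proof (clarify)
    fix g assume g: "g ^ 4 dvd a" "g ^ 6 dvd b"
    show "is_unit g"
    proof (rule ccontr)
      assume nu: "\<not> is_unit g"
      have "\<exists>x. root_of g x"
        using nu ex_root[of g] is_unit_iff_degree[of g] by (cases "g = 0") auto
      then obtain x where x: "root_of g x" by blast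
      obtain m where m: "is_minimal_polynomial m x" using minimal_polynomial_exists by blast
      have "m dvd g" using is_minimal_polynomialD(2)[OF m] x by blast
      then have "m ^ 4 dvd a" "m ^ 6 dvd b" using g dvd_power_same dvd_trans by blast+
      then show False using R[rule_format, of x]
        vanishing_order_finite_ge_iff[OF m, of 4] vanishing_order_finite_ge_iff[OF m, of 6]
        by (simp add: numeral_eq_enat del: vanishing_order.simps)
    qed
  qed
qed

text \<open>
  The global sections of \<open>O(4 n) \<oplus> O(6 n)\<close>, dehomogenised.
\<close>
definition bounded_pairs :: "nat \<Rightarrow> ('a::field poly \<times> 'a poly) set" where
  "bounded_pairs n = {(a, b). degree a \<le> 4 * n \<and> degree b \<le> 6 * n}"

lemma minimal_weierstrass_iff:
  fixes a b :: "'a::{field,finite} poly"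
  shows "minimal_weierstrass n a b \<longleftrightarrow>
    primitive (a, b) \<and> (a, b) \<in> bounded_pairs n \<and>
    \<not> ((a = 0 \<or> 4 + degree a \<le> 4 * n) \<and> (b = 0 \<or> 6 + degree b \<le> 6 * n))"
proof -
  have all: "(\<forall>P. Q P) \<longleftrightarrow> (\<forall>x. Q (Finite_point x)) \<and> Q Point_at_infinity"
    for Q :: "'a alg_closure proj_line \<Rightarrow> bool"
    by (metis proj_line.exhaust)
  have inf: "4 \<le> vanishing_order (4 * n) a Point_at_infinity \<longleftrightarrow> a = 0 \<or> 4 + degree a \<le> 4 * n"
    "6 \<le> vanishing_order (6 * n) b Point_at_infinity \<longleftrightarrow> b = 0 \<or> 6 + degree b \<le> 6 * n"
    using vanishing_order_infinity_ge_iff[of 4 "4 * n" a] vanishing_order_infinity_ge_iff[of 6 "6 * n" b]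
    by (simp_all add: numeral_eq_enat)
  show ?thesis
    unfolding minimal_weierstrass_def all inf primitive_iff_finite_points[of a b "4 * n" "6 * n"]
    by (auto simp: sections_def bounded_pairs_def simp del: vanishing_order.simps)
qed

text \<open>
  For a primitive pair the condition at infinity says precisely that \<open>k\<close> is the least index for
  which the degree bounds hold.  So the minimal equations with index at most \<open>n\<close> are the primitive
  pairs that satisfy the bounds for \<open>n\<close>, and the point at infinity disappears from the count.
\<close>
lemma ex_minimal_weierstrass_iff:
  fixes a b :: "'a::{field,finite} poly"
  shows "(\<exists>k\<le>n. minimal_weierstrass k a b) \<longleftrightarrow> primitive (a, b) \<and> (a, b) \<in> bounded_pairs n"
proof
  assume "\<exists>k\<le>n. minimal_weierstrass k a b"
  then show "primitive (a, b) \<and> (a, b) \<in> bounded_pairs n"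
    unfolding minimal_weierstrass_iff bounded_pairs_def by (auto intro: order_trans)
next
  assume *: "primitive (a, b) \<and> (a, b) \<in> bounded_pairs n"
  define k where "k = (LEAST k. (a, b) \<in> bounded_pairs k)"
  have k: "(a, b) \<in> bounded_pairs k" unfolding k_def using * LeastI by metis
  have kn: "k \<le> n" unfolding k_def using * Least_le by metis
  have "a \<noteq> 0 \<or> b \<noteq> 0" using * by auto
  have "\<not> ((a = 0 \<or> 4 + degree a \<le> 4 * k) \<and> (b = 0 \<or> 6 + degree b \<le> 6 * k))"
  proof
    assume c: "(a = 0 \<or> 4 + degree a \<le> 4 * k) \<and> (b = 0 \<or> 6 + degree b \<le> 6 * k)"
    then have "k > 0" using \<open>a \<noteq> 0 \<or> b \<noteq> 0\<close> by auto
    then have "(a, b) \<in> bounded_pairs (k - 1)" using c unfolding bounded_pairs_def by auto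
    then have "k \<le> k - 1" unfolding k_def by (rule Least_le)
    then show False using \<open>k > 0\<close> by simp
  qed
  then show "\<exists>k\<le>n. minimal_weierstrass k a b" using * k kn minimal_weierstrass_iff by blast
qed

section \<open>Counting primitive pairs\<close>

definition monic_le :: "nat \<Rightarrow> 'a::field poly set" where
  "monic_le n = {g. lead_coeff g = 1 \<and> degree g \<le> n}"

lemma finite_monic_le [simp]: "finite (monic_le n :: 'a::{field,finite} poly set)"
  by (rule finite_subset[OF _ finite_poly_degree_le[of n]]) (auto simp: monic_le_def)

lemma monic_le_Suc:
  "monic_le (Suc n) = insert 1 ((\<lambda>(c, h). pCons c h) ` (UNIV \<times> monic_le n))"
proof (intro equalityI subsetI)
  fix g :: "'a poly" assume g: "g \<in> monic_le (Suc n)"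
  show "g \<in> insert 1 ((\<lambda>(c, h). pCons c h) ` (UNIV \<times> monic_le n))"
    using g by (cases g) (auto simp: monic_le_def one_pCons split: if_splits)
qed (auto simp: monic_le_def split: if_splits)

text \<open>
  A monic polynomial of degree at most \<open>n + 1\<close> is either \<open>1\<close> or \<open>T h + c\<close> with a unique constant \<open>c\<close>
  and a unique monic \<open>h\<close> of degree at most \<open>n\<close>.
\<close>
lemma sum_monic_le_Suc:
  fixes f :: "nat \<Rightarrow> nat"
  shows "(\<Sum>g\<in>(monic_le (Suc n) :: 'a::{field,finite} poly set). f (Suc n - degree g)) =
    f (Suc n) + CARD('a) * (\<Sum>g\<in>(monic_le n :: 'a poly set). f (n - degree g))"
proof -
  let ?P = "(\<lambda>(c, h :: 'a poly). pCons c h) ` (UNIV \<times> monic_le n)"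
  have "1 \<notin> ?P" by (auto simp: one_pCons monic_le_def)
  then have "(\<Sum>g\<in>(monic_le (Suc n) :: 'a poly set). f (Suc n - degree g)) =
      f (Suc n) + (\<Sum>g\<in>?P. f (Suc n - degree g))"
    by (simp add: monic_le_Suc)
  also have "(\<Sum>g\<in>?P. f (Suc n - degree g)) =
      (\<Sum>(c :: 'a, h :: 'a poly)\<in>UNIV \<times> monic_le n. f (Suc n - degree (pCons c h)))"
    using inj_on_subset[OF inj_pCons, of "UNIV \<times> monic_le n"]
    by (subst sum.reindex) (simp_all add: case_prod_unfold comp_def del: degree_pCons_eq_if)
  also have "\<dots> = (\<Sum>(c :: 'a, h :: 'a poly)\<in>UNIV \<times> monic_le n. f (n - degree h))"
    by (intro sum.cong refl) (auto simp: monic_le_def)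
  also have "\<dots> = CARD('a) * (\<Sum>g\<in>(monic_le n :: 'a poly set). f (n - degree g))"
    by (simp add: sum.cartesian_product[symmetric])
  finally show ?thesis .
qed

lemma scale_in_bounded_pairs_iff:
  fixes g :: "'a::field poly"
  assumes "g \<noteq> 0" "p \<noteq> (0, 0)"
  shows "scale g p \<in> bounded_pairs n \<longleftrightarrow> degree g \<le> n \<and> p \<in> bounded_pairs (n - degree g)"
proof -
  obtain a b where p: "p = (a, b)" by fastforce
  have "degree (g ^ 4 * a) = (if a = 0 then 0 else 4 * degree g + degree a)"
    "degree (g ^ 6 * b) = (if b = 0 then 0 else 6 * degree g + degree b)"
    using assms(1) by (simp_all add: degree_mult_eq degree_power_eq)
  then show ?thesis
    using assms(2) unfolding p bounded_pairs_def scale_def by auto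
qed

text \<open>
  The families of curves that are counted (all of them, \<open>a\<^sub>4 = 0\<close>, \<open>a\<^sub>6 = 0\<close>, discriminant zero) are
  all stable under scaling and unscaling, which is what the recursion below rests on.
\<close>
definition scale_invariant :: "('a::field poly \<times> 'a poly) set \<Rightarrow> bool" where
  "scale_invariant W \<longleftrightarrow> (\<forall>g p. g \<noteq> 0 \<longrightarrow> (scale g p \<in> W \<longleftrightarrow> p \<in> W))"

definition nonzero_pairs :: "('a::field poly \<times> 'a poly) set \<Rightarrow> nat \<Rightarrow> ('a poly \<times> 'a poly) set" where
  "nonzero_pairs W n = {p \<in> W \<inter> bounded_pairs n. p \<noteq> (0, 0)}"

definition primitive_pairs :: "('a::field poly \<times> 'a poly) set \<Rightarrow> nat \<Rightarrow> ('a poly \<times> 'a poly) set" where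
  "primitive_pairs W n = {p \<in> W \<inter> bounded_pairs n. primitive p}"

lemma bounded_pairs_eq: "bounded_pairs n = {a. degree a \<le> 4 * n} \<times> {b. degree b \<le> 6 * n}"
  unfolding bounded_pairs_def by auto

lemma finite_bounded_pairs [simp]: "finite (bounded_pairs n :: ('a::{field,finite} poly \<times> 'a poly) set)"
  by (simp add: bounded_pairs_eq finite_poly_degree_le)

lemma finite_primitive_pairs [simp]: "finite (primitive_pairs W n :: ('a::{field,finite} poly \<times> 'a poly) set)"
  by (rule finite_subset[OF _ finite_bounded_pairs[of n]]) (auto simp: primitive_pairs_def)

text \<open>
  Every nonzero pair is \<open>scale g p\<close> for a unique monic \<open>g\<close> and a unique primitive \<open>p\<close>; extracting \<open>g\<close>
  lowers the index of the degree bounds by exactly \<open>degree g\<close>.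
\<close>
lemma card_nonzero_pairs:
  fixes W :: "('a::{field,finite} poly \<times> 'a poly) set"
  assumes W: "scale_invariant W"
  shows "card (nonzero_pairs W n) = 
    (\<Sum>g\<in>(monic_le n :: 'a poly set). card (primitive_pairs W (n - degree g)))"
proof -
  let ?S = "SIGMA g:(monic_le n :: 'a poly set). primitive_pairs W (n - degree g)"
  have inv: "scale g p \<in> W \<longleftrightarrow> p \<in> W" if "g \<noteq> 0" for g p
    using W that unfolding scale_invariant_def by blast
  have nz: "p \<noteq> (0, 0)" if "primitive p" for p :: "'a poly \<times> 'a poly" using that by auto
  have "bij_betw (\<lambda>(g, p). scale g p) ?S (nonzero_pairs W n)"
    unfolding bij_betw_def
  proof
    show "inj_on (\<lambda>(g, p). scale g p) ?S"
      unfolding inj_on_def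
      by (auto simp: monic_le_def primitive_pairs_def dest: monic_primitive_scale_unique)
    show "(\<lambda>(g, p). scale g p) ` ?S = nonzero_pairs W n"
    proof (intro equalityI subsetI)
      fix r assume "r \<in> (\<lambda>(g, p). scale g p) ` ?S"
      then obtain g p where r: "r = scale g p" "g \<in> monic_le n" "p \<in> primitive_pairs W (n - degree g)"
        by auto
      then have "g \<noteq> 0" and p: "p \<noteq> (0, 0)" using nz by (auto simp: monic_le_def primitive_pairs_def)
      then show "r \<in> nonzero_pairs W n"
        using r inv[of g p] scale_in_bounded_pairs_iff[of g p n] scale_eq_0_iff[of g p]
        unfolding nonzero_pairs_def monic_le_def primitive_pairs_def by auto
    next
      fix r assume r: "r \<in> nonzero_pairs W n"
      then obtain g p where gp: "lead_coeff g = 1" "primitive p" "r = scale g p"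
        using ex_primitive_scale unfolding nonzero_pairs_def by blast
      then have "g \<noteq> 0" and p: "p \<noteq> (0, 0)" using nz by auto
      then have "(g, p) \<in> ?S"
        using r gp inv[of g p] scale_in_bounded_pairs_iff[of g p n]
        unfolding nonzero_pairs_def monic_le_def primitive_pairs_def by auto
      then show "r \<in> (\<lambda>(g, p). scale g p) ` ?S" using gp(3) by force
    qed
  qed
  then have "card (nonzero_pairs W n) = card ?S" by (rule bij_betw_same_card[symmetric])
  then show ?thesis by simp
qed

text \<open>
  In terms of generating series: that of the nonzero pairs is that of the minimal pairs of exact
  index \<open>n\<close> times the zeta function \<open>1 / ((1 - T) (1 - q T))\<close> of the projective line.  Multiplying by
  \<open>1 - q T\<close> leaves the factor \<open>1 / (1 - T)\<close>, that is, the summation over all indices up to \<open>n\<close>, which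
  \<open>primitive_pairs W n\<close> already incorporates.
\<close>
lemma card_primitive_pairs_Suc:
  fixes W :: "('a::{field,finite} poly \<times> 'a poly) set"
  assumes "scale_invariant W"
  shows "card (nonzero_pairs W (Suc n)) =
    card (primitive_pairs W (Suc n)) + CARD('a) * card (nonzero_pairs W n)"
  using sum_monic_le_Suc[where ?'a = 'a and f = "\<lambda>m. card (primitive_pairs W m)" and n = n]
  by (simp only: card_nonzero_pairs[OF assms])

section \<open>The four families of pairs\<close>

definition singular_pairs :: "('a::field poly \<times> 'a poly) set" where
  "singular_pairs = {(a, b). 4 * a ^ 3 + 27 * b ^ 2 = 0}"

lemma scale_invariant_UNIV: "scale_invariant UNIV"
  by (simp add: scale_invariant_def)

lemma scale_invariant_zero_fst: "scale_invariant {p. fst p = 0}"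
  by (auto simp: scale_invariant_def scale_def case_prod_unfold)

lemma scale_invariant_zero_snd: "scale_invariant {p. snd p = 0}"
  by (auto simp: scale_invariant_def scale_def case_prod_unfold)

lemma scale_invariant_singular_pairs: "scale_invariant singular_pairs"
proof -
  have "4 * (g ^ 4 * a) ^ 3 + 27 * (g ^ 6 * b) ^ 2 = g ^ 12 * (4 * a ^ 3 + 27 * b ^ 2)"
    for g a b :: "'a poly"
    by (simp add: power_mult_distrib algebra_simps flip: power_mult)
  then show ?thesis
    unfolding scale_invariant_def singular_pairs_def scale_def by (simp add: case_prod_unfold)
qed

lemma card_nonzero_pairs_UNIV:
  "card (nonzero_pairs (UNIV :: ('a::{field,finite} poly \<times> 'a poly) set) n) = CARD('a) ^ (10 * n + 2) - 1"
proof -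
  have "nonzero_pairs (UNIV :: ('a poly \<times> 'a poly) set) n = bounded_pairs n - {(0, 0)}"
    unfolding nonzero_pairs_def by auto
  moreover have "(0, 0) \<in> (bounded_pairs n :: ('a poly \<times> 'a poly) set)"
    by (simp add: bounded_pairs_def)
  moreover have "card (bounded_pairs n :: ('a poly \<times> 'a poly) set) = CARD('a) ^ (10 * n + 2)"
    by (simp add: bounded_pairs_eq card_cartesian_product card_poly_degree_le flip: power_add)
  ultimately show ?thesis by simp
qed

lemma card_nonzero_poly_degree_le:
  "card {f :: 'a::{zero,finite} poly. f \<noteq> 0 \<and> degree f \<le> k} = CARD('a) ^ Suc k - 1"
proof -
  have "{f :: 'a poly. f \<noteq> 0 \<and> degree f \<le> k} = {f. degree f \<le> k} - {0}" by auto
  then show ?thesis by (simp add: card_poly_degree_le card_Diff_singleton)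
qed

lemma card_nonzero_pairs_zero_fst:
  "card (nonzero_pairs {p :: 'a::{field,finite} poly \<times> 'a poly. fst p = 0} n) = CARD('a) ^ (6 * n + 1) - 1"
proof -
  have "nonzero_pairs {p :: 'a poly \<times> 'a poly. fst p = 0} n = Pair 0 ` {b. b \<noteq> 0 \<and> degree b \<le> 6 * n}"
    unfolding nonzero_pairs_def bounded_pairs_def by auto
  then show ?thesis by (simp add: card_image inj_on_def card_nonzero_poly_degree_le)
qed

lemma card_nonzero_pairs_zero_snd:
  "card (nonzero_pairs {p :: 'a::{field,finite} poly \<times> 'a poly. snd p = 0} n) = CARD('a) ^ (4 * n + 1) - 1"
proof -
  have "nonzero_pairs {p :: 'a poly \<times> 'a poly. snd p = 0} n =
      (\<lambda>a. (a, 0)) ` {a. a \<noteq> 0 \<and> degree a \<le> 4 * n}"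
    unfolding nonzero_pairs_def bounded_pairs_def by auto
  then show ?thesis by (simp add: card_image inj_on_def card_nonzero_poly_degree_le)
qed

text \<open>
  The ring of polynomials is integrally closed; this is what makes the parameter of a singular
  curve a polynomial.
\<close>
lemma square_dvd_square_imp_dvd:
  fixes f g :: "'a::field poly"
  assumes "f ^ 2 dvd g ^ 2"
  shows "f dvd g"
  using assms
proof (induction "degree f" arbitrary: f g rule: less_induct)
  case less
  show ?case
  proof (cases "f = 0 \<or> degree f = 0")
    case True
    then show ?thesis using less.prems is_unit_iff_degree[of f] by (cases "f = 0") auto
  next
    case False
    then obtain s where s: "prime_elem s" "s dvd f" using ex_prime_dvd by blast
    then obtain f' where f: "f = s * f'" by (elim dvdE)
    have "s dvd f ^ 2" using s(2) by (simp add: power2_eq_square)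
    then have "s dvd g ^ 2" using less.prems by (rule dvd_trans)
    then have "s dvd g" using s(1) prime_elem_dvd_power by blast
    then obtain g' where g: "g = s * g'" by (elim dvdE)
    have "s \<noteq> 0" using s(1) by auto
    then have "f' ^ 2 dvd g' ^ 2" using less.prems unfolding f g by (simp add: power_mult_distrib)
    moreover have "degree f' < degree f"
      using prime_elem_degree_pos[OF s(1)] False \<open>s \<noteq> 0\<close> unfolding f by (auto simp: degree_mult_eq)
    ultimately have "f' dvd g'" using less.hyps by blast
    then show ?thesis unfolding f g by simp
  qed
qed

lemma numeral_poly_dvd_1:
  assumes "(numeral k :: 'a::field) \<noteq> 0"
  shows "(numeral k :: 'a poly) dvd 1"
  using assms by (simp add: numeral_poly is_unit_const_poly_iff dvd_field_iff)

text \<open>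
  The cuspidal cubic \<open>4 a\<^sup>3 + 27 b\<^sup>2 = 0\<close> is parametrised by the abscissa \<open>c\<close> of the singular point:
  \<open>x\<^sup>3 - 3 c\<^sup>2 x + 2 c\<^sup>3 = (x - c)\<^sup>2 (x + 2 c)\<close>.  From the equation \<open>a\<^sup>2\<close> divides \<open>b\<^sup>2\<close>, so \<open>a\<close> divides
  \<open>b\<close>, and \<open>c = -3 b / (2 a)\<close> is a polynomial.
\<close>
lemma singular_pairs_parametrisation:
  fixes a b :: "'a::field poly"
  assumes char: "(2 :: 'a) \<noteq> 0" "(3 :: 'a) \<noteq> 0"
  shows "(a, b) \<in> singular_pairs \<longleftrightarrow> (\<exists>c. a = - 3 * c ^ 2 \<and> b = 2 * c ^ 3)"
proof
  assume "\<exists>c. a = - 3 * c ^ 2 \<and> b = 2 * c ^ 3"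
  then show "(a, b) \<in> singular_pairs"
    unfolding singular_pairs_def by (auto simp: power_mult_distrib simp flip: power_mult)
next
  have two: "(2 :: 'a poly) \<noteq> 0" and three: "(3 :: 'a poly) \<noteq> 0"
    using char by (simp_all add: numeral_poly)
  have four: "(4 :: 'a poly) \<noteq> 0"
    using two by (metis mult_2 mult_eq_0_iff numeral_Bit0)
  have "(27 :: 'a) = 3 ^ 3" by simp
  then have "(27 :: 'a) \<noteq> 0" using char(2) by (metis power_not_zero)
  then have u: "(27 :: 'a poly) dvd 1" by (rule numeral_poly_dvd_1)
  assume "(a, b) \<in> singular_pairs"
  then have eq: "4 * a ^ 3 + 27 * b ^ 2 = 0" by (simp add: singular_pairs_def)
  then have "27 * b ^ 2 = a ^ 2 * (- 4 * a)" by (simp add: eq_neg_iff_add_eq_0 power3_eq_cube power2_eq_square algebra_simps)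
  then have "a ^ 2 dvd 27 * b ^ 2" by (metis dvd_triv_left)
  then have "a ^ 2 dvd b ^ 2" using u dvd_mult_unit_iff' by blast
  then obtain d where d: "b = a * d" using square_dvd_square_imp_dvd by (blast elim: dvdE)
  show "\<exists>c. a = - 3 * c ^ 2 \<and> b = 2 * c ^ 3"
  proof (cases "a = 0")
    case True
    then show ?thesis using d by (intro exI[of _ 0]) simp
  next
    case False
    \<comment> \<open>With \<open>b = a d\<close> this is \<open>c = - 3 b / (2 a)\<close>.\<close>
    define c where "c = smult (- 3 / 2) d"
    have "(6 :: 'a) = 3 * 2" by simp
    then have "(6 :: 'a) / 2 = 3" using char(1) by (metis nonzero_mult_div_cancel_right)
    then have "smult 3 d = smult (6 / 2) d" by (simp only:)
    then have cd: "3 * d = - (2 * c)"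
      unfolding c_def by (simp add: numeral_poly)
    have "a ^ 2 * (4 * a + 27 * d ^ 2) = 0"
      using eq unfolding d by (simp add: power3_eq_cube power2_eq_square algebra_simps)
    then have "4 * a + 27 * d ^ 2 = 0" using False by simp
    also have "27 * d ^ 2 = 3 * (3 * d) ^ 2" by (simp add: power_mult_distrib)
    also have "\<dots> = 12 * c ^ 2" unfolding cd by (simp add: power_mult_distrib)
    also have "4 * a + 12 * c ^ 2 = 4 * (a + 3 * c ^ 2)" by (simp add: algebra_simps)
    finally have "a + 3 * c ^ 2 = 0" using four by (metis mult_eq_0_iff)
    then have a: "a = - 3 * c ^ 2" by (simp add: eq_neg_iff_add_eq_0)
    have "3 * b = a * (3 * d)" unfolding d by simp
    also have "\<dots> = 3 * (2 * c ^ 3)" unfolding cd a by (simp add: power3_eq_cube power2_eq_square)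
    finally have "b = 2 * c ^ 3" using three mult_left_cancel[of 3 b "2 * c ^ 3"] by blast
    then show ?thesis using a by blast
  qed
qed

text \<open>
  The degree bounds on \<open>-3 c\<^sup>2\<close> and \<open>2 c\<^sup>3\<close> both amount to \<open>degree c \<le> 2 n\<close>.
\<close>
lemma card_nonzero_singular_pairs:
  assumes char: "(2 :: 'a::{field,finite}) \<noteq> 0" "(3 :: 'a) \<noteq> 0"
  shows "card (nonzero_pairs (singular_pairs :: ('a poly \<times> 'a poly) set) n) = CARD('a) ^ (2 * n + 1) - 1"
proof -
  define \<phi> :: "'a poly \<Rightarrow> 'a poly \<times> 'a poly" where "\<phi> = (\<lambda>c. (- 3 * c ^ 2, 2 * c ^ 3))"
  have two: "(2 :: 'a poly) \<noteq> 0" and three: "(3 :: 'a poly) \<noteq> 0"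
    using char by (simp_all add: numeral_poly)
  have deg: "degree (- 3 * c ^ 2) = 2 * degree c" "degree (2 * c ^ 3) = 3 * degree c" if "c \<noteq> 0" for c :: "'a poly"
    using that two three by (simp_all add: degree_mult_eq degree_power_eq)
  have "nonzero_pairs singular_pairs n = \<phi> ` {c. c \<noteq> 0 \<and> degree c \<le> 2 * n}"
  proof (intro equalityI subsetI)
    fix p :: "'a poly \<times> 'a poly" assume p: "p \<in> nonzero_pairs singular_pairs n"
    then obtain c where c: "p = \<phi> c"
      using singular_pairs_parametrisation[OF char] unfolding nonzero_pairs_def \<phi>_def
      by (cases p) blast
    moreover from c p have "c \<noteq> 0" unfolding nonzero_pairs_def \<phi>_def by auto
    moreover from this p have "degree c \<le> 2 * n"
      using deg[of c] unfolding c nonzero_pairs_def \<phi>_def bounded_pairs_def by simp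
    ultimately show "p \<in> \<phi> ` {c. c \<noteq> 0 \<and> degree c \<le> 2 * n}" by blast
  next
    fix p :: "'a poly \<times> 'a poly" assume "p \<in> \<phi> ` {c. c \<noteq> 0 \<and> degree c \<le> 2 * n}"
    then obtain c where c: "p = \<phi> c" "c \<noteq> 0" "degree c \<le> 2 * n" by blast
    then have "p \<in> singular_pairs"
      using singular_pairs_parametrisation[OF char] unfolding \<phi>_def by blast
    then show "p \<in> nonzero_pairs singular_pairs n"
      using c deg[of c] two unfolding nonzero_pairs_def \<phi>_def bounded_pairs_def by simp
  qed
  moreover have "inj_on \<phi> {c. c \<noteq> 0 \<and> degree c \<le> 2 * n}"
  proof (rule inj_onI)
    fix c d assume cd: "c \<in> {c. c \<noteq> 0 \<and> degree c \<le> 2 * n}" "\<phi> c = \<phi> d"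
    then have "c ^ 2 = d ^ 2" "c ^ 3 = d ^ 3" using two three unfolding \<phi>_def by auto
    then have "c * c ^ 2 = d * c ^ 2" by (simp add: power3_eq_cube power2_eq_square)
    then show "c = d" using cd(1) by simp
  qed
  ultimately show ?thesis by (simp add: card_image card_nonzero_poly_degree_le)
qed

section \<open>The groupoid of Weierstrass equations\<close>

text \<open>
  The equation \<open>E\<close> from which the substitution \<open>(u, r, s, t)\<close> leads to the given \<open>E'\<close>.  Solving
  \<open>weierstrass_iso\<close> for \<open>E\<close> rather than for \<open>E'\<close> avoids all denominators, so that the groupoid laws
  become polynomial identities.
\<close>
fun transform :: "'k::field \<times> 'k \<times> 'k \<times> 'k \<Rightarrow> 'k weierstrass \<Rightarrow> 'k weierstrass" where
  "transform (u, r, s, t) (Weierstrass a1 a2 a3 a4 a6) =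
     Weierstrass
       (u * a1 - 2 * s)
       (u^2 * a2 + s * u * a1 - 3 * r - s^2)
       (u^3 * a3 - r * u * a1 + 2 * r * s - 2 * t)
       (u^4 * a4 + s * u^3 * a3 - 2 * r * u^2 * a2 + (t - 2 * r * s) * u * a1
          + 3 * r^2 + 2 * r * s^2 - 2 * s * t)
       (u^6 * a6 - r * u^4 * a4 + r^2 * u^2 * a2 + (t - r * s) * u^3 * a3
          - r * (t - r * s) * u * a1 - r^3 - (t - r * s)^2)"

text \<open>
  Composition of substitutions, read off from inserting \<open>x' = u'\<^sup>2 x'' + r'\<close> and
  \<open>y' = u'\<^sup>3 y'' + s' u'\<^sup>2 x'' + t'\<close> into \<open>x = u\<^sup>2 x' + r\<close> and \<open>y = u\<^sup>3 y' + s u\<^sup>2 x' + t\<close>.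
\<close>
fun compose :: "'k::field \<times> 'k \<times> 'k \<times> 'k \<Rightarrow> 'k \<times> 'k \<times> 'k \<times> 'k \<Rightarrow> 'k \<times> 'k \<times> 'k \<times> 'k" where
  "compose (u, r, s, t) (u', r', s', t') =
     (u * u', u^2 * r' + r, u * s' + s, u^3 * t' + s * u^2 * r' + t)"

fun inverse_substitution :: "'k::field \<times> 'k \<times> 'k \<times> 'k \<Rightarrow> 'k \<times> 'k \<times> 'k \<times> 'k" where
  "inverse_substitution (u, r, s, t) = (1 / u, - (r / u^2), - (s / u), (r * s - t) / u^3)"

lemma weierstrass_iso_iff_transform:
  "weierstrass_iso E E' \<phi> \<longleftrightarrow> fst \<phi> \<noteq> 0 \<and> E = transform \<phi> E'"
proof -
  obtain a1 a2 a3 a4 a6 where E: "E = Weierstrass a1 a2 a3 a4 a6" by (cases E)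
  obtain b1 b2 b3 b4 b6 where E': "E' = Weierstrass b1 b2 b3 b4 b6" by (cases E')
  obtain u r s t where \<phi>: "\<phi> = (u, r, s, t)" by (cases \<phi>)
  have 1: "u * b1 = a1 + 2 * s \<longleftrightarrow> a1 = u * b1 - 2 * s" by (auto simp: algebra_simps)
  have 2: "u^2 * b2 = a2 - s * a1 + 3 * r - s^2 \<longleftrightarrow> a2 = u^2 * b2 + s * u * b1 - 3 * r - s^2"
    if "a1 = u * b1 - 2 * s"
    unfolding that by (auto simp: algebra_simps power2_eq_square)
  have 3: "u^3 * b3 = a3 + r * a1 + 2 * t \<longleftrightarrow> a3 = u^3 * b3 - r * u * b1 + 2 * r * s - 2 * t"
    if "a1 = u * b1 - 2 * s"
    unfolding that by (auto simp: algebra_simps)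
  have 4: "u^4 * b4 = a4 - s * a3 + 2 * r * a2 - (t + r * s) * a1 + 3 * r^2 - 2 * s * t \<longleftrightarrow>
      a4 = u^4 * b4 + s * u^3 * b3 - 2 * r * u^2 * b2 + (t - 2 * r * s) * u * b1
          + 3 * r^2 + 2 * r * s^2 - 2 * s * t"
    if "a1 = u * b1 - 2 * s" "a2 = u^2 * b2 + s * u * b1 - 3 * r - s^2"
      "a3 = u^3 * b3 - r * u * b1 + 2 * r * s - 2 * t"
    unfolding that by (auto simp: algebra_simps power2_eq_square)
  have 6: "u^6 * b6 = a6 + r * a4 + r^2 * a2 + r^3 - t * a3 - t^2 - r * t * a1 \<longleftrightarrow>
      a6 = u^6 * b6 - r * u^4 * b4 + r^2 * u^2 * b2 + (t - r * s) * u^3 * b3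
          - r * (t - r * s) * u * b1 - r^3 - (t - r * s)^2"
    if "a1 = u * b1 - 2 * s" "a2 = u^2 * b2 + s * u * b1 - 3 * r - s^2"
      "a3 = u^3 * b3 - r * u * b1 + 2 * r * s - 2 * t"
      "a4 = u^4 * b4 + s * u^3 * b3 - 2 * r * u^2 * b2 + (t - 2 * r * s) * u * b1
          + 3 * r^2 + 2 * r * s^2 - 2 * s * t"
    unfolding that by (auto simp: algebra_simps power2_eq_square power3_eq_cube)
  show ?thesis
    unfolding E E' \<phi> using 1 2 3 4 6 by (simp del: One_nat_def cong: conj_cong)
qed

lemma transform_compose:
  "transform \<phi> (transform \<psi> E) = transform (compose \<phi> \<psi>) E"
proof -
  obtain a1 a2 a3 a4 a6 where E: "E = Weierstrass a1 a2 a3 a4 a6" by (cases E)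
  obtain u r s t where \<phi>: "\<phi> = (u, r, s, t)" by (cases \<phi>)
  obtain u' r' s' t' where \<psi>: "\<psi> = (u', r', s', t')" by (cases \<psi>)
  show ?thesis
    unfolding E \<phi> \<psi> transform.simps compose.simps weierstrass.inject
    by (intro conjI) (simp_all add: algebra_simps eval_nat_numeral)
qed

lemma compose_assoc: "compose (compose \<phi> \<psi>) \<chi> = compose \<phi> (compose \<psi> \<chi>)"
proof -
  obtain u r s t where \<phi>: "\<phi> = (u, r, s, t)" by (cases \<phi>)
  obtain u' r' s' t' where \<psi>: "\<psi> = (u', r', s', t')" by (cases \<psi>)
  obtain u'' r'' s'' t'' where \<chi>: "\<chi> = (u'', r'', s'', t'')" by (cases \<chi>)
  show ?thesis
    unfolding \<phi> \<psi> \<chi> compose.simps prod.inject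
    by (intro conjI) (simp_all add: algebra_simps eval_nat_numeral)
qed

lemma compose_id_left [simp]: "compose (1, 0, 0, 0) \<phi> = \<phi>"
  by (cases \<phi>) simp

lemma transform_id [simp]: "transform (1, 0, 0, 0) E = E"
  by (cases E) simp

lemma compose_inverse:
  assumes "fst \<phi> \<noteq> 0"
  shows "compose \<phi> (inverse_substitution \<phi>) = (1, 0, 0, 0)"
    "compose (inverse_substitution \<phi>) \<phi> = (1, 0, 0, 0)"
  using assms by (cases \<phi>; simp add: field_simps power2_eq_square power3_eq_cube)+

lemma fst_compose [simp]: "fst (compose \<phi> \<psi>) = fst \<phi> * fst \<psi>"
  by (cases \<phi>; cases \<psi>) simp

lemma fst_inverse_substitution [simp]: "fst (inverse_substitution \<phi>) = 1 / fst \<phi>"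
  by (cases \<phi>) simp

lemma weierstrass_iso_refl: "weierstrass_iso E E (1, 0, 0, 0)"
  by (simp add: weierstrass_iso_iff_transform)

lemma weierstrass_iso_sym:
  "weierstrass_iso E E' \<phi> \<Longrightarrow> weierstrass_iso E' E (inverse_substitution \<phi>)"
  by (auto simp: weierstrass_iso_iff_transform transform_compose compose_inverse)

lemma weierstrass_iso_trans:
  "weierstrass_iso E E' \<phi> \<Longrightarrow> weierstrass_iso E' E'' \<psi> \<Longrightarrow> weierstrass_iso E E'' (compose \<phi> \<psi>)"
  by (auto simp: weierstrass_iso_iff_transform transform_compose)

lemma equiv_isomorphism_relation: "equiv UNIV isomorphism_relation"
proof (rule equivI)
  show "refl isomorphism_relation"
    unfolding refl_on_def isomorphism_relation_def using weierstrass_iso_refl by blast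
  show "sym isomorphism_relation"
    unfolding sym_def isomorphism_relation_def using weierstrass_iso_sym by blast
  show "trans isomorphism_relation"
    unfolding trans_def isomorphism_relation_def using weierstrass_iso_trans by blast
qed simp

text \<open>
  Conjugation by an isomorphism identifies the automorphism groups.
\<close>
lemma card_automorphisms_cong:
  assumes "(E, E') \<in> isomorphism_relation"
  shows "card (automorphisms E) = card (automorphisms E')"
proof -
  obtain \<phi> where \<phi>: "weierstrass_iso E E' \<phi>" using assms by (auto simp: isomorphism_relation_def)
  let ?\<psi> = "inverse_substitution \<phi>"
  have nz: "fst \<phi> \<noteq> 0" using \<phi> by (simp add: weierstrass_iso_iff_transform)
  note \<psi> = weierstrass_iso_sym[OF \<phi>]
  have "bij_betw (\<lambda>\<alpha>. compose ?\<psi> (compose \<alpha> \<phi>)) (automorphisms E) (automorphisms E')"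
  proof (rule bij_betw_byWitness[where f' = "\<lambda>\<beta>. compose \<phi> (compose \<beta> ?\<psi>)"])
    have "compose \<alpha> (1, 0, 0, 0) = \<alpha>" for \<alpha> :: "'a \<times> 'a \<times> 'a \<times> 'a" by (cases \<alpha>) simp
    then show "\<forall>\<alpha>\<in>automorphisms E. compose \<phi> (compose (compose ?\<psi> (compose \<alpha> \<phi>)) ?\<psi>) = \<alpha>"
      "\<forall>\<beta>\<in>automorphisms E'. compose ?\<psi> (compose (compose \<phi> (compose \<beta> ?\<psi>)) \<phi>) = \<beta>"
      by (metis compose_assoc compose_id_left compose_inverse[OF nz])+
    show "(\<lambda>\<alpha>. compose ?\<psi> (compose \<alpha> \<phi>)) ` automorphisms E \<subseteq> automorphisms E'"
      "(\<lambda>\<beta>. compose \<phi> (compose \<beta> ?\<psi>)) ` automorphisms E' \<subseteq> automorphisms E"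
      unfolding automorphisms_def using \<phi> \<psi> weierstrass_iso_trans by blast+
  qed
  then show ?thesis by (rule bij_betw_same_card)
qed

lemma short_weierstrass_iso_iff:
  fixes a b a' b' :: "'k::field"
  assumes "(2 :: 'k) \<noteq> 0" "(3 :: 'k) \<noteq> 0"
  shows "weierstrass_iso (Weierstrass 0 0 0 a b) (Weierstrass 0 0 0 a' b') (u, r, s, t) \<longleftrightarrow>
    u \<noteq> 0 \<and> r = 0 \<and> s = 0 \<and> t = 0 \<and> u ^ 4 * a' = a \<and> u ^ 6 * b' = b"
  using assms by auto

text \<open>
  The invariants of every equation isomorphic to \<open>y\<^sup>2 = x\<^sup>3 + a x + b\<close>.  Expanding the discriminant in
  the five coefficients would be unwieldy; the quantities \<open>b\<^sub>2\<close>, \<open>b\<^sub>4\<close>, \<open>b\<^sub>6\<close>, \<open>b\<^sub>8\<close> do not depend on \<open>s\<close> and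
  \<open>t\<close>, and the rest is an identity in \<open>r\<close>, \<open>u\<^sup>4 a\<close> and \<open>u\<^sup>6 b\<close>.
\<close>
lemma invariants_of_short_weierstrass:
  fixes a b u r s t :: "'k::field"
  shows "discriminant (transform (u, r, s, t) (Weierstrass 0 0 0 a b)) =
      - 16 * u ^ 12 * (4 * a ^ 3 + 27 * b ^ 2)" (is ?D)
    and "c4_invariant (transform (u, r, s, t) (Weierstrass 0 0 0 a b)) = - 48 * u ^ 4 * a" (is ?C)
proof -
  define A where "A = u ^ 4 * a"
  define B where "B = u ^ 6 * b"
  define a1 where "a1 = - 2 * s"
  define a2 where "a2 = - 3 * r - s ^ 2"
  define a3 where "a3 = 2 * r * s - 2 * t"
  define a4 where "a4 = A + 3 * r ^ 2 + 2 * r * s ^ 2 - 2 * s * t"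
  define a6 where "a6 = B - r * A - r ^ 3 - (t - r * s) ^ 2"
  note defs = a1_def a2_def a3_def a4_def a6_def
  have E: "transform (u, r, s, t) (Weierstrass 0 0 0 a b) = Weierstrass a1 a2 a3 a4 a6"
    by (simp add: defs A_def B_def)
  have b2: "a1 ^ 2 + 4 * a2 = - 12 * r"
    unfolding defs by (simp add: algebra_simps eval_nat_numeral)
  have b4: "2 * a4 + a1 * a3 = 2 * A + 6 * r ^ 2"
    unfolding defs by (simp add: algebra_simps eval_nat_numeral)
  have b6: "a3 ^ 2 + 4 * a6 = 4 * (B - r * A - r ^ 3)"
    unfolding defs by (simp add: algebra_simps eval_nat_numeral)
  have b8: "a1 ^ 2 * a6 + 4 * a2 * a6 - a1 * a3 * a4 + a2 * a3 ^ 2 - a4 ^ 2 =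
      - (A ^ 2) - 12 * r * B + 6 * r ^ 2 * A + 3 * r ^ 4"
    unfolding defs by (simp add: algebra_simps eval_nat_numeral)
  have "discriminant (Weierstrass a1 a2 a3 a4 a6) = - 16 * (4 * A ^ 3 + 27 * B ^ 2)"
    unfolding discriminant.simps Let_def b2 b4 b6 b8 by (simp add: algebra_simps eval_nat_numeral)
  also have "\<dots> = - 16 * u ^ 12 * (4 * a ^ 3 + 27 * b ^ 2)"
    unfolding A_def B_def by (simp add: power_mult_distrib algebra_simps flip: power_mult)
  finally show ?D unfolding E .
  have "c4_invariant (Weierstrass a1 a2 a3 a4 a6) = - 48 * A"
    unfolding c4_invariant.simps Let_def b2 b4 by (simp add: algebra_simps eval_nat_numeral)
  then show ?C unfolding E A_def by (simp only: mult.assoc)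
qed

section \<open>Isomorphism classes as orbits\<close>

abbreviation curve_of :: "'a::field poly \<times> 'a poly \<Rightarrow> 'a poly fract weierstrass" where
  "curve_of \<equiv> (\<lambda>(a, b). generic_fibre a b)"

lemma to_fract_of_nat: "to_fract (of_nat n) = of_nat n"
  by (induction n) simp_all

lemma to_fract_numeral: "to_fract (numeral n) = numeral n"
  using to_fract_of_nat[of "numeral n"] by simp

lemma to_fract_power: "to_fract (x ^ n) = to_fract x ^ n"
  by (induction n) simp_all

lemma numeral_poly_fract_nonzero:
  assumes "(numeral k :: 'a::field) \<noteq> 0"
  shows "(numeral k :: 'a poly fract) \<noteq> 0"
proof -
  have "(numeral k :: 'a poly) \<noteq> 0" using assms by (simp add: numeral_poly)
  then show ?thesis by (metis to_fract_numeral to_fract_eq_0_iff)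
qed

lemma fract_cases_to_fract:
  fixes x :: "'a::idom fract"
  obtains f g where "g \<noteq> 0" "x = to_fract f / to_fract g"
  by (cases x) (auto simp: Fract_conv_to_fract)

text \<open>
  Away from characteristic 2 and 3 an isomorphism of short equations is a scaling by some \<open>u\<close> in the
  function field.  Writing \<open>u = f / g\<close> gives \<open>scale f p' = scale g p\<close>, and primitivity of both pairs
  forces \<open>f\<close> and \<open>g\<close> to be proportional.  So isomorphism classes are orbits of the nonzero constants.
\<close>
lemma curve_of_iso_iff:
  fixes p p' :: "'a::field poly \<times> 'a poly"
  assumes char: "(2 :: 'a) \<noteq> 0" "(3 :: 'a) \<noteq> 0" and "primitive p" "primitive p'"
  shows "weierstrass_iso (curve_of p) (curve_of p') \<phi> \<longleftrightarrow>
    (\<exists>c. c \<noteq> 0 \<and> \<phi> = (to_fract [:c:], 0, 0, 0) \<and> p = scale [:c:] p')"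
proof -
  obtain a b where p: "p = (a, b)" by fastforce
  obtain a' b' where p': "p' = (a', b')" by fastforce
  obtain u r s t where \<phi>: "\<phi> = (u, r, s, t)" by (cases \<phi>)
  have iso: "weierstrass_iso (curve_of p) (curve_of p') \<phi> \<longleftrightarrow>
    u \<noteq> 0 \<and> r = 0 \<and> s = 0 \<and> t = 0 \<and>
    u ^ 4 * to_fract a' = to_fract a \<and> u ^ 6 * to_fract b' = to_fract b"
    unfolding p p' \<phi> generic_fibre_def prod.case
    using char by (intro short_weierstrass_iso_iff numeral_poly_fract_nonzero)
  show ?thesis
  proof
    assume "weierstrass_iso (curve_of p) (curve_of p') \<phi>"
    then have h: "u \<noteq> 0" "r = 0" "s = 0" "t = 0"
      "u ^ 4 * to_fract a' = to_fract a" "u ^ 6 * to_fract b' = to_fract b"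
      unfolding iso by auto
    obtain f g where fg: "g \<noteq> 0" "u = to_fract f / to_fract g" by (rule fract_cases_to_fract)
    then have f: "f \<noteq> 0" using h(1) by auto
    have "to_fract (f ^ 4 * a') = to_fract (g ^ 4 * a)" "to_fract (f ^ 6 * b') = to_fract (g ^ 6 * b)"
      using h(5,6) fg by (auto simp: to_fract_power field_simps power_divide)
    then have "scale f p' = scale g p"
      unfolding p p' scale_def by (simp only: to_fract_eq_iff prod.case)
    then obtain c where c: "c \<noteq> 0" "g = smult c f"
      using primitive_scale_unique[of p' p f g] assms(3,4) fg(1) f by blast
    define d where "d = inverse c"
    have d: "d \<noteq> 0" "f = [:d:] * g" using c unfolding d_def by auto
    have "to_fract f = to_fract [:d:] * to_fract g" unfolding d(2) by (rule to_fract_mult)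
    then have u: "u = to_fract [:d:]" using fg by simp
    then have "to_fract ([:d:] ^ 4 * a') = to_fract a" "to_fract ([:d:] ^ 6 * b') = to_fract b"
      using h(5,6) by (simp_all only: to_fract_power to_fract_mult)
    then have "p = scale [:d:] p'"
      unfolding p p' scale_def by (simp only: to_fract_eq_iff prod.case)
    then show "\<exists>c. c \<noteq> 0 \<and> \<phi> = (to_fract [:c:], 0, 0, 0) \<and> p = scale [:c:] p'"
      using d u h \<phi> by blast
  next
    assume "\<exists>c. c \<noteq> 0 \<and> \<phi> = (to_fract [:c:], 0, 0, 0) \<and> p = scale [:c:] p'"
    then obtain c where "c \<noteq> 0" "\<phi> = (to_fract [:c:], 0, 0, 0)" "p = scale [:c:] p'" by blast
    then show "weierstrass_iso (curve_of p) (curve_of p') \<phi>"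
      unfolding iso using p p' \<phi> by (simp add: scale_def to_fract_power del: mult_pCons_left)
  qed
qed

definition stabiliser :: "'a::field poly \<times> 'a poly \<Rightarrow> 'a set" where
  "stabiliser p = {c. c \<noteq> 0 \<and> scale [:c:] p = p}"

lemma card_automorphisms_curve_of:
  fixes p :: "'a::field poly \<times> 'a poly"
  assumes "(2 :: 'a) \<noteq> 0" "(3 :: 'a) \<noteq> 0" "primitive p"
  shows "card (automorphisms (curve_of p)) = card (stabiliser p)"
proof -
  have "automorphisms (curve_of p) = (\<lambda>c. (to_fract [:c:], 0, 0, 0)) ` stabiliser p"
    unfolding automorphisms_def curve_of_iso_iff[OF assms assms(3)] stabiliser_def by auto
  then show ?thesis by (simp add: card_image inj_on_def)
qed

lemma card_orbit_times_card_stabiliser: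
  fixes p :: "'a::{field,finite} poly \<times> 'a poly"
  shows "card ((\<lambda>c. scale [:c:] p) ` (UNIV - {0})) * card (stabiliser p) = CARD('a) - 1"
proof -
  let ?f = "\<lambda>c. scale [:c:] p"
  have fibre: "card {c \<in> UNIV - {0}. ?f c = ?f d} = card (stabiliser p)" if "d \<noteq> 0" for d
  proof -
    have "{c \<in> UNIV - {0}. ?f c = ?f d} = (\<lambda>c. d * c) ` stabiliser p"
    proof (intro equalityI subsetI)
      fix c assume c: "c \<in> {c \<in> UNIV - {0}. ?f c = ?f d}"
      have "scale [:d:] (scale [:c / d:] p) = scale [:d:] p"
        using c that by (simp add: scale_scale)
      then have "c / d \<in> stabiliser p"
        using c that scale_cancel[of "[:d:]"] unfolding stabiliser_def by simp
      then show "c \<in> (\<lambda>c. d * c) ` stabiliser p"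
        using that by (intro image_eqI[of _ _ "c / d"]) auto
    next
      fix c assume "c \<in> (\<lambda>c. d * c) ` stabiliser p"
      then obtain e where e: "e \<noteq> 0" "scale [:e:] p = p" "c = d * e" by (auto simp: stabiliser_def)
      have "?f c = scale [:d:] (scale [:e:] p)" unfolding scale_scale e(3) by (simp add: mult.commute)
      then have "?f c = ?f d" unfolding e(2) .
      then show "c \<in> {c \<in> UNIV - {0}. ?f c = ?f d}" using e that by simp
    qed
    then show ?thesis using that by (simp add: card_image inj_on_def)
  qed
  have "CARD('a) - 1 = (\<Sum>c\<in>UNIV - {0 :: 'a}. 1)" by (simp add: card_Diff_singleton)
  also have "\<dots> = (\<Sum>y\<in>?f ` (UNIV - {0}). \<Sum>c\<in>{c \<in> UNIV - {0}. ?f c = y}. 1)"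
    by (rule sum.image_gen) simp
  also have "\<dots> = (\<Sum>y\<in>?f ` (UNIV - {0}). card (stabiliser p))"
  proof (rule sum.cong[OF refl])
    fix y assume "y \<in> ?f ` (UNIV - {0})"
    then obtain d where "d \<noteq> 0" "y = ?f d" by blast
    then show "(\<Sum>c\<in>{c \<in> UNIV - {0}. ?f c = y}. 1) = card (stabiliser p)"
      using fibre[of d] by simp
  qed
  finally show ?thesis by simp
qed

definition curves_of :: "('a::field poly \<times> 'a poly) set \<Rightarrow> 'a poly fract weierstrass set" where
  "curves_of F = {E. \<exists>p\<in>F. (E, curve_of p) \<in> isomorphism_relation}"

definition iso_class :: "'a::field poly \<times> 'a poly \<Rightarrow> 'a poly fract weierstrass set" where
  "iso_class p = isomorphism_relation `` {curve_of p}"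

lemma curves_of_quotient: "curves_of F // isomorphism_relation = iso_class ` F"
proof (intro equalityI subsetI)
  fix C assume "C \<in> curves_of F // isomorphism_relation"
  then obtain E p where "C = isomorphism_relation `` {E}" "p \<in> F" "(E, curve_of p) \<in> isomorphism_relation"
    unfolding quotient_def curves_of_def by auto
  then show "C \<in> iso_class ` F"
    using equiv_class_eq[OF equiv_isomorphism_relation] unfolding iso_class_def by blast
next
  fix C assume "C \<in> iso_class ` F"
  then show "C \<in> curves_of F // isomorphism_relation"
    using equiv_isomorphism_relation
    unfolding quotient_def curves_of_def iso_class_def equiv_def refl_on_def by blast
qed

text \<open>
  The pairs in \<open>F\<close> that give the class \<open>C\<close> form one orbit of the \<open>q - 1\<close> nonzero constants.  By the
  orbit-stabiliser theorem they contribute \<open>\<phi> C\<close> times \<open>q - 1\<close> to the sum on the right.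
\<close>
lemma sum_isomorphism_classes:
  fixes F :: "('a::{field,finite} poly \<times> 'a poly) set" and \<phi> :: "_ \<Rightarrow> real"
  assumes char: "(2 :: 'a) \<noteq> 0" "(3 :: 'a) \<noteq> 0"
    and F: "finite F" "\<And>p. p \<in> F \<Longrightarrow> primitive p"
      "\<And>c p. c \<noteq> 0 \<Longrightarrow> p \<in> F \<Longrightarrow> scale [:c:] p \<in> F"
  shows "(\<Sum>C\<in>curves_of F // isomorphism_relation. \<phi> C) * (real CARD('a) - 1) =
    (\<Sum>p\<in>F. \<phi> (iso_class p) * card (stabiliser p))"
proof -
  have q: "real CARD('a) - 1 = real (CARD('a) - 1)"
    using finite_UNIV_card_ge_0[where ?'a = 'a] by simp
  have fibre: "{p \<in> F. iso_class p = iso_class p0} = (\<lambda>c. scale [:c:] p0) ` (UNIV - {0})"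
    if "p0 \<in> F" for p0
  proof -
    have "iso_class p = iso_class p0 \<longleftrightarrow> (\<exists>c. c \<noteq> 0 \<and> p = scale [:c:] p0)" if "p \<in> F" for p
    proof -
      have "iso_class p = iso_class p0 \<longleftrightarrow> (curve_of p, curve_of p0) \<in> isomorphism_relation"
        unfolding iso_class_def using eq_equiv_class_iff[OF equiv_isomorphism_relation] by blast
      also have "\<dots> \<longleftrightarrow> (\<exists>\<phi>. weierstrass_iso (curve_of p) (curve_of p0) \<phi>)"
        by (simp add: isomorphism_relation_def)
      also have "\<dots> \<longleftrightarrow> (\<exists>c. c \<noteq> 0 \<and> p = scale [:c:] p0)"
        using curve_of_iso_iff[OF char F(2)[OF that] F(2)[OF \<open>p0 \<in> F\<close>]] by blast
      finally show ?thesis .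
    qed
    then show ?thesis using F(3)[OF _ that] by (intro equalityI subsetI) blast+
  qed
  have card_stab: "card (stabiliser p) = card (stabiliser p0)" if "p0 \<in> F" "p \<in> F" "iso_class p = iso_class p0" for p p0
  proof -
    have "(curve_of p, curve_of p0) \<in> isomorphism_relation"
      using that(3) eq_equiv_class_iff[OF equiv_isomorphism_relation] unfolding iso_class_def by blast
    then show ?thesis
      using card_automorphisms_cong card_automorphisms_curve_of[OF char F(2)] that by metis
  qed
  have "(\<Sum>p\<in>F. \<phi> (iso_class p) * card (stabiliser p)) =
      (\<Sum>C\<in>iso_class ` F. \<Sum>p\<in>{p \<in> F. iso_class p = C}. \<phi> (iso_class p) * card (stabiliser p))"
    by (rule sum.image_gen[OF F(1)])
  also have "\<dots> = (\<Sum>C\<in>iso_class ` F. \<phi> C * (real CARD('a) - 1))"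
  proof (rule sum.cong[OF refl])
    fix C assume "C \<in> iso_class ` F"
    then obtain p0 where p0: "p0 \<in> F" "C = iso_class p0" by blast
    have "(\<Sum>p\<in>{p \<in> F. iso_class p = C}. \<phi> (iso_class p) * card (stabiliser p)) =
        (\<Sum>p\<in>{p \<in> F. iso_class p = C}. \<phi> C * card (stabiliser p0))"
    proof (rule sum.cong[OF refl])
      fix p assume "p \<in> {p \<in> F. iso_class p = C}"
      then have p: "p \<in> F" "iso_class p = C" by blast+
      then have "card (stabiliser p) = card (stabiliser p0)"
        using card_stab[OF p0(1)] unfolding p0(2) by blast
      then show "\<phi> (iso_class p) * card (stabiliser p) = \<phi> C * card (stabiliser p0)"
        using p(2) by simp
    qed
    also have "\<dots> = \<phi> C * real (card {p \<in> F. iso_class p = C} * card (stabiliser p0))" by simp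
    also have "card {p \<in> F. iso_class p = C} * card (stabiliser p0) = CARD('a) - 1"
      unfolding p0(2) fibre[OF p0(1)] by (rule card_orbit_times_card_stabiliser)
    finally show "(\<Sum>p\<in>{p \<in> F. iso_class p = C}. \<phi> (iso_class p) * card (stabiliser p)) =
        \<phi> C * (real CARD('a) - 1)" unfolding q .
  qed
  also have "\<dots> = (\<Sum>C\<in>iso_class ` F. \<phi> C) * (real CARD('a) - 1)"
    by (simp add: sum_distrib_right)
  finally show ?thesis unfolding curves_of_quotient by simp
qed

text \<open>
  In the weighted count the order of the automorphism group cancels the order of the stabiliser, so
  only the number of pairs remains; the unweighted count keeps the stabilisers.
\<close>
lemma counts_of_curves_of:
  fixes F :: "('a::{field,finite} poly \<times> 'a poly) set"
  assumes char: "(2 :: 'a) \<noteq> 0" "(3 :: 'a) \<noteq> 0"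
    and F: "finite F" "\<And>p. p \<in> F \<Longrightarrow> primitive p"
      "\<And>c p. c \<noteq> 0 \<Longrightarrow> p \<in> F \<Longrightarrow> scale [:c:] p \<in> F"
  shows "weighted_count (curves_of F) * (real CARD('a) - 1) = card F"
    and "real (unweighted_count (curves_of F)) * (real CARD('a) - 1) = (\<Sum>p\<in>F. card (stabiliser p))"
proof -
  have "weighted_count (curves_of F) * (real CARD('a) - 1) =
      (\<Sum>p\<in>F. 1 / real (card (automorphisms (SOME E. E \<in> iso_class p))) * card (stabiliser p))"
    unfolding weighted_count_def by (rule sum_isomorphism_classes[OF assms])
  also have "\<dots> = (\<Sum>p\<in>F. 1)"
  proof (rule sum.cong[OF refl])
    fix p assume p: "p \<in> F"
    have "curve_of p \<in> iso_class p"
      using equiv_isomorphism_relation unfolding iso_class_def equiv_def refl_on_def by blast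
    then have "(SOME E. E \<in> iso_class p) \<in> iso_class p" by (rule someI)
    then have "card (automorphisms (curve_of p)) = card (automorphisms (SOME E. E \<in> iso_class p))"
      unfolding iso_class_def by (intro card_automorphisms_cong) simp
    moreover have "card (automorphisms (curve_of p)) = card (stabiliser p)"
      by (rule card_automorphisms_curve_of[OF char F(2)[OF p]])
    moreover have "card (stabiliser p) \<noteq> 0"
    proof -
      have "1 \<in> stabiliser p" by (simp add: stabiliser_def flip: one_pCons)
      then show ?thesis by auto
    qed
    ultimately show "1 / real (card (automorphisms (SOME E. E \<in> iso_class p))) * card (stabiliser p) = 1"
      by simp
  qed
  finally show "weighted_count (curves_of F) * (real CARD('a) - 1) = card F" by simp
  show "real (unweighted_count (curves_of F)) * (real CARD('a) - 1) = (\<Sum>p\<in>F. card (stabiliser p))"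
    using sum_isomorphism_classes[OF assms, of "\<lambda>_. 1"] by (simp add: unweighted_count_def)
qed

section \<open>Roots of unity and stabilisers\<close>

lemma finite_field_power_card_minus_1:
  fixes x :: "'a::{field,finite}"
  assumes "x \<noteq> 0"
  shows "x ^ (CARD('a) - 1) = 1"
proof -
  have "(\<Prod>y\<in>UNIV - {0}. x * y) = (\<Prod>y\<in>UNIV - {0 :: 'a}. y)"
    by (rule prod.reindex_bij_witness[of _ "\<lambda>y. y / x" "\<lambda>y. x * y"]) (use assms in auto)
  then show ?thesis by (simp add: prod.distrib card_Diff_singleton)
qed

lemma CARD_field_ge_2: "CARD('a::{field,finite}) \<ge> 2"
proof -
  have "card {0, 1 :: 'a} \<le> CARD('a)" by (rule card_mono) auto
  then show ?thesis by simp
qed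

text \<open>
  \<open>T\<^sup>d - 1\<close> divides \<open>T\<^bsup>q-1\<^esup> - 1\<close>, which has all \<open>q - 1\<close> nonzero elements as roots.  The cofactor has at
  most \<open>q - 1 - d\<close> of them, so \<open>T\<^sup>d - 1\<close> has at least \<open>d\<close>.
\<close>
lemma card_roots_of_unity_dvd:
  assumes "d dvd CARD('a::{field,finite}) - 1"
  shows "card {x :: 'a. x ^ d = 1} = d"
proof -
  let ?q = "CARD('a)"
  obtain k where k: "?q - 1 = d * k" using assms by (elim dvdE)
  have "?q - 1 > 0" using CARD_field_ge_2[where ?'a = 'a] by simp
  then have "d > 0" "k > 0" using k by (auto intro: gr0I)
  define f where "f = monom (1 :: 'a) d - 1"
  define h where "h = (\<Sum>i<k. monom (1 :: 'a) d ^ i)"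
  have fh: "f * h = monom 1 (?q - 1) - 1"
    unfolding f_def h_def k using power_diff_1_eq[of "monom (1 :: 'a) d" k] by (simp add: monom_power)
  have deg: "degree (monom (1 :: 'a) n - 1) = n" if "n > 0" for n
    using that degree_add_eq_left[of "- 1" "monom (1 :: 'a) n"] by (simp add: degree_monom_eq)
  have "f * h \<noteq> 0" using deg[of "?q - 1"] \<open>?q - 1 > 0\<close> unfolding fh by force
  then have nz: "f \<noteq> 0" "h \<noteq> 0" by auto
  have "degree f + degree h = ?q - 1"
    using degree_mult_eq[OF nz] deg[of "?q - 1"] \<open>?q - 1 > 0\<close> unfolding fh by simp
  then have dh: "degree f = d" "degree h = ?q - 1 - d" using deg[OF \<open>d > 0\<close>] unfolding f_def by auto
  have rf: "{x. poly f x = 0} = {x. x ^ d = 1}" unfolding f_def by (simp add: poly_monom)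
  have "UNIV - {0} \<subseteq> {x. poly f x = 0} \<union> {x. poly h x = 0}"
  proof
    fix x :: 'a assume "x \<in> UNIV - {0}"
    then have "poly (f * h) x = 0"
      unfolding fh using finite_field_power_card_minus_1[of x] by (simp add: poly_monom)
    then show "x \<in> {x. poly f x = 0} \<union> {x. poly h x = 0}" by simp
  qed
  then have "card (UNIV - {0 :: 'a}) \<le> card ({x. poly f x = 0} \<union> {x. poly h x = 0})"
    by (intro card_mono) auto
  also have "\<dots> \<le> card {x. poly f x = 0} + card {x. poly h x = 0}" by (rule card_Un_le)
  also have "card {x. poly h x = 0} \<le> ?q - 1 - d" using card_poly_roots_bound[OF nz(2)] dh(2) by simp
  finally have "?q - 1 \<le> card {x. poly f x = 0} + (?q - 1 - d)" by (simp add: card_Diff_singleton)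
  moreover have "d \<le> ?q - 1" using k \<open>k > 0\<close> by simp
  moreover have "card {x. poly f x = 0} \<le> d" using card_poly_roots_bound[OF nz(1)] dh(1) by simp
  ultimately show ?thesis unfolding rf by linarith
qed

lemma power_eq_1_gcd:
  fixes x :: "'a::idom"
  assumes "x ^ i = 1" "x ^ j = 1" "i > 0"
  shows "x ^ gcd i j = 1"
proof -
  obtain k l where "i * k = j * l + gcd i j" using bezout_nat[of i j] assms(3) by auto
  then have "x ^ (i * k) = x ^ (j * l) * x ^ gcd i j" by (simp add: power_add)
  then show ?thesis using assms by (simp add: power_mult)
qed

lemma card_roots_of_unity:
  assumes "d > 0"
  shows "card {x :: 'a::{field,finite}. x ^ d = 1} = gcd d (CARD('a) - 1)"
proof -
  have "x ^ gcd d (CARD('a) - 1) = 1" if "x ^ d = 1" for x :: 'a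
  proof -
    have "x \<noteq> 0" using that assms by (auto simp: power_0_left)
    then show ?thesis using power_eq_1_gcd[OF that _ assms] finite_field_power_card_minus_1 by blast
  qed
  moreover have "x ^ d = 1" if "x ^ gcd d (CARD('a) - 1) = 1" for x :: 'a
    using that by (metis dvd_def gcd_dvd1 power_mult power_one)
  ultimately have "{x :: 'a. x ^ d = 1} = {x. x ^ gcd d (CARD('a) - 1) = 1}" by blast
  then show ?thesis by (simp add: card_roots_of_unity_dvd)
qed

lemma even_CARD_minus_1:
  assumes "(2 :: 'a::{field,finite}) \<noteq> 0"
  shows "even (CARD('a) - 1)"
proof (rule ccontr)
  assume "odd (CARD('a) - 1)"
  then have "(-1 :: 'a) = 1" using finite_field_power_card_minus_1[of "-1 :: 'a"] by simp
  then show False using assms by (metis add.right_inverse one_add_one)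
qed

text \<open>
  As \<open>q - 1\<close> is even, \<open>gcd 4 (q - 1)\<close> and \<open>gcd 6 (q - 1)\<close> are 2 unless 4, respectively 6, divides
  \<open>q - 1\<close>; hence the excess over 2 is a multiple of \<open>delta\<close>.
\<close>
lemma card_roots_of_unity_2_4_6:
  assumes "(2 :: 'a::{field,finite}) \<noteq> 0"
  shows "card {x :: 'a. x ^ 2 = 1} = 2"
    and "real (card {x :: 'a. x ^ 4 = 1}) = 2 + 2 * delta 4 CARD('a)"
    and "real (card {x :: 'a. x ^ 6 = 1}) = 2 + 4 * delta 6 CARD('a)"
proof -
  let ?m = "CARD('a) - 1"
  have ev: "even ?m" by (rule even_CARD_minus_1[OF assms])
  show "card {x :: 'a. x ^ 2 = 1} = 2" by (rule card_roots_of_unity_dvd[OF ev])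
  have g: "gcd d ?m = 2" if "even d" "\<not> d dvd ?m" "\<And>k. k dvd d \<Longrightarrow> even k \<Longrightarrow> k = 2 \<or> k = d" for d
  proof -
    have "even (gcd d ?m)" using that(1) ev by simp
    then have "gcd d ?m = 2 \<or> gcd d ?m = d" using that(3)[of "gcd d ?m"] by simp
    moreover have "gcd d ?m \<noteq> d" using that(2) by (metis gcd_dvd2)
    ultimately show ?thesis by blast
  qed
  have "gcd 4 ?m = 2" if "\<not> 4 dvd ?m"
  proof (rule g)
    fix k :: nat assume k: "k dvd 4" "even k"
    then have "k \<le> 4" by (intro dvd_imp_le) auto
    then have "k = 0 \<or> k = 2 \<or> k = 4" using k(2) by presburger
    then show "k = 2 \<or> k = 4" using k(1) by auto
  qed (use that in auto)
  then show "real (card {x :: 'a. x ^ 4 = 1}) = 2 + 2 * delta 4 CARD('a)"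
    by (auto simp: card_roots_of_unity delta_def gcd_nat.absorb1)
  have "gcd 6 ?m = 2" if "\<not> 6 dvd ?m"
  proof (rule g)
    fix k :: nat assume k: "k dvd 6" "even k"
    then have "k \<le> 6" by (intro dvd_imp_le) auto
    then have "k = 0 \<or> k = 2 \<or> k = 4 \<or> k = 6" using k(2) by presburger
    then show "k = 2 \<or> k = 6" using k(1) by auto
  qed (use that in auto)
  then show "real (card {x :: 'a. x ^ 6 = 1}) = 2 + 4 * delta 6 CARD('a)"
    by (auto simp: card_roots_of_unity delta_def gcd_nat.absorb1)
qed

text \<open>
  The stabiliser is \<open>\<mu>\<^sub>6\<close> if \<open>a = 0\<close>, \<open>\<mu>\<^sub>4\<close> if \<open>b = 0\<close>, and \<open>\<mu>\<^sub>2 = \<mu>\<^sub>4 \<inter> \<mu>\<^sub>6\<close> otherwise.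
\<close>
lemma card_stabiliser:
  fixes a b :: "'a::{field,finite} poly"
  assumes "(2 :: 'a) \<noteq> 0" "(a, b) \<noteq> (0, 0)"
  shows "real (card (stabiliser (a, b))) =
    2 + (if a = 0 then 4 * delta 6 CARD('a) else 0) + (if b = 0 then 2 * delta 4 CARD('a) else 0)"
proof -
  have sm: "[:c:] ^ k * f = f \<longleftrightarrow> f = 0 \<or> c ^ k = 1" for c :: 'a and k f
  proof -
    have "[:c:] ^ k * f = f \<longleftrightarrow> smult (c ^ k - 1) f = 0"
      by (simp add: poly_const_pow smult_diff_left)
    then show ?thesis by auto
  qed
  have st: "stabiliser (a, b) = {c. c \<noteq> 0 \<and> (a = 0 \<or> c ^ 4 = 1) \<and> (b = 0 \<or> c ^ 6 = 1)}"
    unfolding stabiliser_def scale_def prod.case prod.inject sm ..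
  have u: "c \<noteq> 0" if "c ^ k = 1" "k > 0" for c :: 'a and k
    using that by (auto simp: power_0_left)
  consider "a = 0" "b \<noteq> 0" | "a \<noteq> 0" "b = 0" | "a \<noteq> 0" "b \<noteq> 0" using assms(2) by auto
  then show ?thesis
  proof cases
    case 1
    then have "stabiliser (a, b) = {c. c ^ 6 = 1}" using u unfolding st by auto
    then show ?thesis using 1 card_roots_of_unity_2_4_6(3)[OF assms(1)] by simp
  next
    case 2
    then have "stabiliser (a, b) = {c. c ^ 4 = 1}" using u unfolding st by auto
    then show ?thesis using 2 card_roots_of_unity_2_4_6(2)[OF assms(1)] by simp
  next
    case 3
    have "c ^ 2 = 1" if "c ^ 4 = 1" "c ^ 6 = 1" for c :: 'a
    proof -
      have "c ^ 6 = c ^ 4 * c ^ 2" by (simp flip: power_add)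
      then show ?thesis using that by simp
    qed
    moreover have "c ^ 4 = 1" "c ^ 6 = 1" if "c ^ 2 = 1" for c :: 'a
    proof -
      have "c ^ 4 = (c ^ 2) ^ 2" "c ^ 6 = (c ^ 2) ^ 3" by (simp_all flip: power_mult)
      then show "c ^ 4 = 1" "c ^ 6 = 1" using that by simp_all
    qed
    ultimately have "stabiliser (a, b) = {c. c ^ 2 = 1}" using 3 u unfolding st by auto
    then show ?thesis using 3 card_roots_of_unity_2_4_6(1)[OF assms(1)] by simp
  qed
qed

section \<open>The counting functions\<close>

lemma weierstrass_upto_eq:
  fixes n :: nat
  shows "(weierstrass_upto (real (CARD('a::{field,finite}) ^ (12 * n))) :: 'a poly fract weierstrass set) =
    curves_of (primitive_pairs UNIV n)"
proof -
  have "real (CARD('a) ^ (12 * k)) \<le> real (CARD('a) ^ (12 * n)) \<longleftrightarrow> k \<le> n" for k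
    using CARD_field_ge_2[where ?'a = 'a] by (simp add: power_increasing_iff)
  then have "(weierstrass_upto (real (CARD('a) ^ (12 * n))) :: 'a poly fract weierstrass set) =
      {E. \<exists>a b. (\<exists>k\<le>n. minimal_weierstrass k a b) \<and> (E, generic_fibre a b) \<in> isomorphism_relation}"
    unfolding weierstrass_upto_def minimal_model_def by blast
  then show ?thesis
    unfolding ex_minimal_weierstrass_iff curves_of_def primitive_pairs_def by auto
qed

lemma curves_of_filter:
  assumes "\<And>E p. p \<in> F \<Longrightarrow> (E, curve_of p) \<in> isomorphism_relation \<Longrightarrow> P E \<longleftrightarrow> p \<in> G"
  shows "{E \<in> curves_of F. P E} = curves_of (F \<inter> G)"
  using assms unfolding curves_of_def by blast

text \<open>
  The statement about \<open>j = 1728\<close> comes from \<open>c\<^sub>4\<^sup>3 - 1728 \<Delta> = c\<^sub>6\<^sup>2\<close> with \<open>c\<^sub>6 = -864 u\<^sup>6 b\<close>.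
\<close>
lemma invariants_of_isomorphic_curve:
  fixes a b :: "'a::field poly"
  assumes char: "(2 :: 'a) \<noteq> 0" "(3 :: 'a) \<noteq> 0"
    and iso: "(E, curve_of (a, b)) \<in> isomorphism_relation"
  shows "is_elliptic E \<longleftrightarrow> (a, b) \<notin> singular_pairs"
    and "is_elliptic E \<Longrightarrow> j_invariant E = 0 \<longleftrightarrow> a = 0"
    and "is_elliptic E \<Longrightarrow> j_invariant E = 1728 \<longleftrightarrow> b = 0"
proof -
  define A where "A = to_fract a"
  define B where "B = to_fract b"
  obtain u r s t where u: "u \<noteq> 0" and E: "E = transform (u, r, s, t) (Weierstrass 0 0 0 A B)"
    using iso unfolding isomorphism_relation_def weierstrass_iso_iff_transform generic_fibre_def A_def B_def
    by auto
  note inv = invariants_of_short_weierstrass[of u r s t A B, folded E]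
  have two: "(2 :: 'a poly fract) \<noteq> 0" and three: "(3 :: 'a poly fract) \<noteq> 0"
    using char by (simp_all only: numeral_poly_fract_nonzero not_False_eq_True)
  have n16: "(16 :: 'a poly fract) \<noteq> 0"
  proof -
    have "(16 :: 'a poly fract) = 2 ^ 4" by simp
    then show ?thesis using two by (metis power_not_zero)
  qed
  have n48: "(48 :: 'a poly fract) \<noteq> 0"
  proof -
    have "(48 :: 'a poly fract) = 16 * 3" by simp
    then show ?thesis using n16 three by (metis mult_eq_0_iff)
  qed
  have n864: "(864 :: 'a poly fract) \<noteq> 0"
  proof -
    have "(864 :: 'a poly fract) = 2 ^ 5 * 3 ^ 3" by simp
    then show ?thesis using two three by (metis mult_eq_0_iff power_not_zero)
  qed
  have "4 * A ^ 3 + 27 * B ^ 2 = to_fract (4 * a ^ 3 + 27 * b ^ 2)"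
    unfolding A_def B_def by (simp add: to_fract_power to_fract_numeral)
  then have "4 * A ^ 3 + 27 * B ^ 2 = 0 \<longleftrightarrow> (a, b) \<in> singular_pairs"
    unfolding singular_pairs_def by (simp only: to_fract_eq_0_iff mem_Collect_eq prod.case)
  then show "is_elliptic E \<longleftrightarrow> (a, b) \<notin> singular_pairs"
    unfolding is_elliptic_def inv using u n16 by simp
  assume "is_elliptic E"
  then have D: "discriminant E \<noteq> 0" by (simp add: is_elliptic_def)
  show "j_invariant E = 0 \<longleftrightarrow> a = 0"
    unfolding j_invariant_def using D u n48 by (simp add: inv(2) A_def)
  have "c4_invariant E ^ 3 - 1728 * discriminant E = (864 * u ^ 6 * B) ^ 2"
    unfolding inv by (simp add: power_mult_distrib algebra_simps flip: power_mult)
  then have "c4_invariant E ^ 3 = 1728 * discriminant E \<longleftrightarrow> B = 0"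
    using u n864 by (metis eq_iff_diff_eq_0 mult_eq_0_iff power_eq_0_iff zero_less_numeral)
  then show "j_invariant E = 1728 \<longleftrightarrow> b = 0"
    unfolding j_invariant_def using D by (simp add: divide_eq_eq B_def)
qed

text \<open>
  If a family has \<open>q\<^bsup>e k + f\<^esup>\<close> pairs, the zero pair included, for every index \<open>k\<close>, then the recursion
  leaves \<open>q\<^bsup>e n + f\<^esup> - q\<^bsup>e (n - 1) + f + 1\<^esup> + (q - 1)\<close> primitive ones.  The quotient is written with
  \<open>g = e - f - 1\<close> to match the shape of the coefficients; the summand \<open>q - 1\<close> appears because the
  zero pair is removed at both indices.
\<close>
lemma card_primitive_pairs_real:
  fixes W :: "('a::{field,finite} poly \<times> 'a poly) set"
  assumes W: "scale_invariant W"
    and e: "e = f + 1 + g"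
    and card: "\<And>k. card (nonzero_pairs W k) = CARD('a) ^ (e * k + f) - 1"
    and "n \<ge> 1"
  defines "q \<equiv> real CARD('a)"
  shows "real (card (primitive_pairs W n)) =
    (q - 1) * ((q ^ (f + g) - 1) / (q ^ (g + 1) - q ^ g) * q ^ (e * n) + 1)"
proof -
  obtain m where n: "n = Suc m" using assms(4) by (cases n) auto
  have q: "q \<ge> 2" using CARD_field_ge_2[where ?'a = 'a] unfolding q_def by simp
  have card': "real (card (nonzero_pairs W k)) = q ^ (e * k + f) - 1" for k
    unfolding card q_def by (simp add: of_nat_diff)
  define z where "z = q ^ (e * m)"
  have "real (card (primitive_pairs W n)) =
      real (card (nonzero_pairs W (Suc m))) - q * real (card (nonzero_pairs W m))"
    using arg_cong[OF card_primitive_pairs_Suc[OF W, of m], of real] unfolding n q_def by simp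
  also have "\<dots> = z * q ^ (f + 1 + g) * q ^ f - 1 - q * (z * q ^ f - 1)"
    unfolding card' z_def e by (simp add: power_add)
  also have "\<dots> = (q ^ (f + g) - 1) * z * q ^ (f + 1) + (q - 1)"
    by (simp add: power_add algebra_simps)
  also have "(q ^ (f + g) - 1) * z * q ^ (f + 1) =
      (q - 1) * ((q ^ (f + g) - 1) / (q ^ (g + 1) - q ^ g) * (z * q ^ (f + 1 + g)))"
  proof -
    have "q ^ (g + 1) - q ^ g = q ^ g * (q - 1)" by (simp add: algebra_simps)
    then show ?thesis using q by (simp add: power_add)
  qed
  also have "z * q ^ (f + 1 + g) = q ^ (e * n)"
    unfolding n z_def e by (simp add: power_add)
  finally show ?thesis by (simp add: algebra_simps)
qed

lemma primitive_pairs_Int: "primitive_pairs V n \<inter> W = primitive_pairs (V \<inter> W) n"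
  unfolding primitive_pairs_def by auto

lemma card_CHAR_gt_3:
  assumes "CHAR('a::field) > 3"
  shows "(2 :: 'a) \<noteq> 0" "(3 :: 'a) \<noteq> 0"
proof -
  have "of_nat k \<noteq> (0 :: 'a)" if "0 < k" "k < CHAR('a)" for k
    using that of_nat_eq_0_iff_char_dvd[where ?'a = 'a] by (auto dest: dvd_imp_le)
  from this[of 2] this[of 3] show "(2 :: 'a) \<noteq> 0" "(3 :: 'a) \<noteq> 0" using assms by simp_all
qed

lemma card_primitive_pairs_UNIV:
  assumes "n \<ge> 1"
  shows "real (card (primitive_pairs (UNIV :: ('a::{field,finite} poly \<times> 'a poly) set) n)) =
    (real CARD('a) - 1) * (coeff_a CARD('a) * real CARD('a) ^ (10 * n) + 1)"
  using card_primitive_pairs_real[where ?'a = 'a and e = 10 and f = 2 and g = 7,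
    OF scale_invariant_UNIV _ card_nonzero_pairs_UNIV assms]
  by (simp add: coeff_a_def)

lemma card_primitive_pairs_zero_fst:
  assumes "n \<ge> 1"
  shows "real (card (primitive_pairs {p :: 'a::{field,finite} poly \<times> 'a poly. fst p = 0} n)) =
    (real CARD('a) - 1) *
    ((real CARD('a) ^ 5 - 1) / (real CARD('a) ^ 5 - real CARD('a) ^ 4) * real CARD('a) ^ (6 * n) + 1)"
  using card_primitive_pairs_real[where ?'a = 'a and e = 6 and f = 1 and g = 4,
    OF scale_invariant_zero_fst _ card_nonzero_pairs_zero_fst assms]
  by simp

lemma card_primitive_pairs_zero_snd:
  assumes "n \<ge> 1"
  shows "real (card (primitive_pairs {p :: 'a::{field,finite} poly \<times> 'a poly. snd p = 0} n)) =
    (real CARD('a) - 1) *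
    ((real CARD('a) ^ 3 - 1) / (real CARD('a) ^ 3 - real CARD('a) ^ 2) * real CARD('a) ^ (4 * n) + 1)"
  using card_primitive_pairs_real[where ?'a = 'a and e = 4 and f = 1 and g = 2,
    OF scale_invariant_zero_snd _ card_nonzero_pairs_zero_snd assms]
  by (simp add: power3_eq_cube mult.assoc)

lemma card_primitive_singular_pairs:
  assumes char: "(2 :: 'a::{field,finite}) \<noteq> 0" "(3 :: 'a) \<noteq> 0" and "n \<ge> 1"
  shows "real (card (primitive_pairs (singular_pairs :: ('a poly \<times> 'a poly) set) n)) =
    (real CARD('a) - 1) * (real CARD('a) ^ (2 * n) + 1)"
  using card_primitive_pairs_real[where ?'a = 'a and e = 2 and f = 1 and g = 0,
    OF scale_invariant_singular_pairs _ card_nonzero_singular_pairs[OF char] assms(3)]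
  using CARD_field_ge_2[where ?'a = 'a] by simp

lemma card_primitive_elliptic_pairs:
  assumes char: "(2 :: 'a::{field,finite}) \<noteq> 0" "(3 :: 'a) \<noteq> 0" and "n \<ge> 1"
  shows "real (card (primitive_pairs (- singular_pairs :: ('a poly \<times> 'a poly) set) n)) =
    (real CARD('a) - 1) * (coeff_a CARD('a) * real CARD('a) ^ (10 * n) - real CARD('a) ^ (2 * n))"
proof -
  let ?ell = "primitive_pairs (- singular_pairs :: ('a poly \<times> 'a poly) set) n"
  let ?sing = "primitive_pairs (singular_pairs :: ('a poly \<times> 'a poly) set) n"
  have "primitive_pairs UNIV n = ?ell \<union> ?sing" "?ell \<inter> ?sing = {}"
    unfolding primitive_pairs_def by auto
  then have "card (primitive_pairs (UNIV :: ('a poly \<times> 'a poly) set) n) = card ?ell + card ?sing"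
    using card_Un_disjoint[of ?ell ?sing] by simp
  then show ?thesis
    using card_primitive_pairs_UNIV[where ?'a = 'a, OF assms(3)] card_primitive_singular_pairs[OF assms]
    by (simp add: algebra_simps)
qed

text \<open>
  For this reason the pairs with an exceptional stabiliser all belong to elliptic curves, namely
  those with \<open>j = 0\<close> or \<open>j = 1728\<close>, and every singular curve has just two automorphisms.
\<close>
lemma zero_coefficient_not_singular:
  fixes a b :: "'a::field poly"
  assumes char: "(2 :: 'a) \<noteq> 0" "(3 :: 'a) \<noteq> 0" and "(a, b) \<noteq> (0, 0)" "a = 0 \<or> b = 0"
  shows "(a, b) \<notin> singular_pairs"
proof -
  have "(2 :: 'a poly) \<noteq> 0" "(3 :: 'a poly) \<noteq> 0" using char by (simp_all add: numeral_poly)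
  moreover have "(27 :: 'a poly) = 3 ^ 3" "(4 :: 'a poly) = 2 ^ 2" by simp_all
  ultimately have "(27 :: 'a poly) \<noteq> 0" "(4 :: 'a poly) \<noteq> 0" by (metis power_not_zero)+
  then show ?thesis using assms(3,4) unfolding singular_pairs_def by auto
qed

text \<open>
  The second formula sums the stabilisers: 2 for every pair and an excess of \<open>4 delta 6 q\<close> or
  \<open>2 delta 4 q\<close> for a pair with a vanishing coefficient.
\<close>
lemma counts_of_primitive_pairs:
  fixes W :: "('a::{field,finite} poly \<times> 'a poly) set"
  assumes char: "(2 :: 'a) \<noteq> 0" "(3 :: 'a) \<noteq> 0"
    and W: "scale_invariant W"
  shows "weighted_count (curves_of (primitive_pairs W n)) =
      card (primitive_pairs W n) / (real CARD('a) - 1)"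
    and "real (unweighted_count (curves_of (primitive_pairs W n))) =
      (2 * real (card (primitive_pairs W n))
        + 4 * delta 6 CARD('a) * real (card (primitive_pairs (W \<inter> {p. fst p = 0}) n))
        + 2 * delta 4 CARD('a) * real (card (primitive_pairs (W \<inter> {p. snd p = 0}) n)))
      / (real CARD('a) - 1)"
proof -
  let ?F = "primitive_pairs W n"
  have closed: "scale [:c:] p \<in> W" if "c \<noteq> 0" "p \<in> W" for c p
    using W that unfolding scale_invariant_def by (metis pCons_eq_0_iff)
  have prim: "primitive p" if "p \<in> ?F" for p
    using that by (simp add: primitive_pairs_def)
  have cl: "scale [:c:] p \<in> ?F" if cp: "c \<noteq> 0" "p \<in> ?F" for c p
  proof -
    have "p \<noteq> (0, 0)" using prim[OF cp(2)] by auto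
    then have "scale [:c:] p \<in> bounded_pairs n"
      using cp scale_in_bounded_pairs_iff[of "[:c:]" p n] by (simp add: primitive_pairs_def)
    moreover have "primitive (scale [:c:] p)"
      using prim[OF cp(2)] cp(1)
      by (simp add: primitive_def scale_def case_prod_unfold poly_const_pow dvd_smult_iff)
    ultimately show ?thesis using closed cp by (simp add: primitive_pairs_def)
  qed
  have q: "real CARD('a) - 1 \<noteq> 0" using CARD_field_ge_2[where ?'a = 'a] by simp
  note C = counts_of_curves_of[OF char finite_primitive_pairs prim cl]
  show "weighted_count (curves_of ?F) = card ?F / (real CARD('a) - 1)"
    using C(1) q by (simp add: eq_divide_eq)
  have stab: "real (card (stabiliser p)) =
      2 + (if fst p = 0 then 4 * delta 6 CARD('a) else 0) + (if snd p = 0 then 2 * delta 4 CARD('a) else 0)"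
    if "p \<in> ?F" for p
  proof -
    obtain a b where p: "p = (a, b)" by fastforce
    have "(a, b) \<noteq> (0, 0)" using prim[OF that] unfolding p by auto
    then show ?thesis using card_stabiliser[OF char(1)] unfolding p by simp
  qed
  have "(\<Sum>p\<in>?F. real (card (stabiliser p))) =
      (\<Sum>p\<in>?F. 2 + (if fst p = 0 then 4 * delta 6 CARD('a) else 0)
        + (if snd p = 0 then 2 * delta 4 CARD('a) else 0))"
    by (rule sum.cong[OF refl stab])
  also have "\<dots> = 2 * real (card ?F)
        + 4 * delta 6 CARD('a) * real (card (?F \<inter> {p. fst p = 0}))
        + 2 * delta 4 CARD('a) * real (card (?F \<inter> {p. snd p = 0}))"
    by (simp add: sum.distrib sum.If_cases)
  finally show "real (unweighted_count (curves_of ?F)) =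
      (2 * real (card ?F)
        + 4 * delta 6 CARD('a) * real (card (primitive_pairs (W \<inter> {p. fst p = 0}) n))
        + 2 * delta 4 CARD('a) * real (card (primitive_pairs (W \<inter> {p. snd p = 0}) n)))
      / (real CARD('a) - 1)"
    using C(2) q by (simp add: primitive_pairs_Int eq_divide_eq)
qed

lemma curves_upto_eq:
  fixes n :: nat
  assumes char: "(2 :: 'a::{field,finite}) \<noteq> 0" "(3 :: 'a) \<noteq> 0"
  defines "B \<equiv> real (CARD('a) ^ (12 * n))"
  shows "(elliptic_upto B :: 'a poly fract weierstrass set) = curves_of (primitive_pairs (- singular_pairs) n)"
    and "(singular_upto B :: 'a poly fract weierstrass set) = curves_of (primitive_pairs singular_pairs n)"
    and "elliptic_upto_with_j (0 :: 'a poly fract) B = curves_of (primitive_pairs {p. fst p = 0} n)"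
    and "elliptic_upto_with_j (1728 :: 'a poly fract) B = curves_of (primitive_pairs {p. snd p = 0} n)"
proof -
  note upto = weierstrass_upto_eq[where ?'a = 'a, of n, folded B_def]
  have inv: "is_elliptic E \<longleftrightarrow> p \<notin> singular_pairs"
    "is_elliptic E \<Longrightarrow> j_invariant E = 0 \<longleftrightarrow> fst p = 0"
    "is_elliptic E \<Longrightarrow> j_invariant E = 1728 \<longleftrightarrow> snd p = 0"
    if "(E, curve_of p) \<in> isomorphism_relation" for E and p :: "'a poly \<times> 'a poly"
    using invariants_of_isomorphic_curve[OF char, of E "fst p" "snd p"] that by simp_all
  have "elliptic_upto B = curves_of (primitive_pairs UNIV n \<inter> (- singular_pairs :: ('a poly \<times> 'a poly) set))"
    unfolding elliptic_upto_def upto by (rule curves_of_filter) (simp add: inv(1))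
  then show ell: "(elliptic_upto B :: 'a poly fract weierstrass set) = curves_of (primitive_pairs (- singular_pairs) n)"
    by (simp add: primitive_pairs_Int)
  have "singular_upto B = curves_of (primitive_pairs UNIV n \<inter> (singular_pairs :: ('a poly \<times> 'a poly) set))"
    unfolding singular_upto_def upto by (rule curves_of_filter) (simp add: inv(1))
  then show "(singular_upto B :: 'a poly fract weierstrass set) = curves_of (primitive_pairs singular_pairs n)"
    by (simp add: primitive_pairs_Int)
  have zero: "primitive_pairs (- singular_pairs) n \<inter> Z = primitive_pairs Z n"
    if "Z = {p. fst p = 0} \<or> Z = {p. snd p = 0}" for Z :: "('a poly \<times> 'a poly) set"
  proof -
    have "p \<notin> singular_pairs" if "p \<in> Z" "primitive p" for p
    proof -
      have "p \<noteq> (0, 0)" using that(2) by auto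
      then show ?thesis
        using zero_coefficient_not_singular[OF char, of "fst p" "snd p"] \<open>p \<in> Z\<close>
          \<open>Z = {p. fst p = 0} \<or> Z = {p. snd p = 0}\<close> by auto
    qed
    then show ?thesis unfolding primitive_pairs_def by auto
  qed
  have "elliptic_upto_with_j (0 :: 'a poly fract) B =
      curves_of (primitive_pairs (- singular_pairs) n \<inter> {p. fst p = 0})"
    unfolding elliptic_upto_with_j_def ell
  proof (rule curves_of_filter)
    fix E and p :: "'a poly \<times> 'a poly"
    assume "p \<in> primitive_pairs (- singular_pairs) n" "(E, curve_of p) \<in> isomorphism_relation"
    then show "j_invariant E = 0 \<longleftrightarrow> p \<in> {p. fst p = 0}"
      using inv(1,2)[of E p] by (simp add: primitive_pairs_def)
  qed
  then show "elliptic_upto_with_j (0 :: 'a poly fract) B = curves_of (primitive_pairs {p. fst p = 0} n)"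
    using zero[of "{p. fst p = 0}"] by simp
  have "elliptic_upto_with_j (1728 :: 'a poly fract) B =
      curves_of (primitive_pairs (- singular_pairs) n \<inter> {p. snd p = 0})"
    unfolding elliptic_upto_with_j_def ell
  proof (rule curves_of_filter)
    fix E and p :: "'a poly \<times> 'a poly"
    assume "p \<in> primitive_pairs (- singular_pairs) n" "(E, curve_of p) \<in> isomorphism_relation"
    then show "j_invariant E = 1728 \<longleftrightarrow> p \<in> {p. snd p = 0}"
      using inv(1,3)[of E p] by (simp add: primitive_pairs_def)
  qed
  then show "elliptic_upto_with_j (1728 :: 'a poly fract) B = curves_of (primitive_pairs {p. snd p = 0} n)"
    using zero[of "{p. snd p = 0}"] by simp
qed

lemma primitive_pairs_zero_families_inter:
  assumes char: "(2 :: 'a::field) \<noteq> 0" "(3 :: 'a) \<noteq> 0"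
  shows "primitive_pairs (- singular_pairs \<inter> {p :: 'a poly \<times> 'a poly. fst p = 0}) n = primitive_pairs {p. fst p = 0} n"
    and "primitive_pairs (- singular_pairs \<inter> {p :: 'a poly \<times> 'a poly. snd p = 0}) n = primitive_pairs {p. snd p = 0} n"
    and "primitive_pairs (singular_pairs \<inter> {p :: 'a poly \<times> 'a poly. fst p = 0}) n = {}"
    and "primitive_pairs (singular_pairs \<inter> {p :: 'a poly \<times> 'a poly. snd p = 0}) n = {}"
    and "primitive_pairs ({p :: 'a poly \<times> 'a poly. fst p = 0} \<inter> {p. snd p = 0}) n = {}"
    and "primitive_pairs ({p :: 'a poly \<times> 'a poly. snd p = 0} \<inter> {p. fst p = 0}) n = {}"
proof -
  have "(a, b) \<notin> singular_pairs" "(a, b) \<noteq> (0, 0)"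
    if "primitive (a, b)" "a = 0 \<or> b = 0" for a b :: "'a poly"
  proof -
    show nz: "(a, b) \<noteq> (0, 0)" using that(1) by auto
    show "(a, b) \<notin> singular_pairs" by (rule zero_coefficient_not_singular[OF char nz that(2)])
  qed
  then show "primitive_pairs (- singular_pairs \<inter> {p :: 'a poly \<times> 'a poly. fst p = 0}) n = primitive_pairs {p. fst p = 0} n"
    "primitive_pairs (- singular_pairs \<inter> {p :: 'a poly \<times> 'a poly. snd p = 0}) n = primitive_pairs {p. snd p = 0} n"
    "primitive_pairs (singular_pairs \<inter> {p :: 'a poly \<times> 'a poly. fst p = 0}) n = {}"
    "primitive_pairs (singular_pairs \<inter> {p :: 'a poly \<times> 'a poly. snd p = 0}) n = {}"
    "primitive_pairs ({p :: 'a poly \<times> 'a poly. fst p = 0} \<inter> {p. snd p = 0}) n = {}"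
    "primitive_pairs ({p :: 'a poly \<times> 'a poly. snd p = 0} \<inter> {p. fst p = 0}) n = {}"
    unfolding primitive_pairs_def by auto
qed

lemma counts_of_families:
  assumes char: "(2 :: 'a::{field,finite}) \<noteq> 0" "(3 :: 'a) \<noteq> 0" and n: "n \<ge> 1"
  defines "q \<equiv> CARD('a)"
  defines "Q \<equiv> real q"
  defines "\<beta> \<equiv> (Q ^ 5 - 1) / (Q ^ 5 - Q ^ 4)" and "\<gamma> \<equiv> (Q ^ 3 - 1) / (Q ^ 3 - Q ^ 2)"
  shows "weighted_count (curves_of (primitive_pairs (- singular_pairs :: ('a poly \<times> 'a poly) set) n)) =
      coeff_a q * Q ^ (10 * n) - Q ^ (2 * n)"
    and "weighted_count (curves_of (primitive_pairs (singular_pairs :: ('a poly \<times> 'a poly) set) n)) =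
      Q ^ (2 * n) + 1"
    and "weighted_count (curves_of (primitive_pairs {p :: 'a poly \<times> 'a poly. fst p = 0} n)) =
      \<beta> * Q ^ (6 * n) + 1"
    and "weighted_count (curves_of (primitive_pairs {p :: 'a poly \<times> 'a poly. snd p = 0} n)) =
      \<gamma> * Q ^ (4 * n) + 1"
    and "real (unweighted_count (curves_of (primitive_pairs (- singular_pairs :: ('a poly \<times> 'a poly) set) n))) =
      2 * (coeff_a q * Q ^ (10 * n) - Q ^ (2 * n))
      + 4 * delta 6 q * (\<beta> * Q ^ (6 * n) + 1) + 2 * delta 4 q * (\<gamma> * Q ^ (4 * n) + 1)"
    and "real (unweighted_count (curves_of (primitive_pairs (singular_pairs :: ('a poly \<times> 'a poly) set) n))) =
      2 * (Q ^ (2 * n) + 1)"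
    and "real (unweighted_count (curves_of (primitive_pairs {p :: 'a poly \<times> 'a poly. fst p = 0} n))) =
      (2 + 4 * delta 6 q) * (\<beta> * Q ^ (6 * n) + 1)"
    and "real (unweighted_count (curves_of (primitive_pairs {p :: 'a poly \<times> 'a poly. snd p = 0} n))) =
      (2 + 2 * delta 4 q) * (\<gamma> * Q ^ (4 * n) + 1)"
proof -
  have Q1: "Q - 1 \<noteq> 0" using CARD_field_ge_2[where ?'a = 'a] unfolding Q_def q_def by simp
  have compl: "scale_invariant (- singular_pairs :: ('a poly \<times> 'a poly) set)"
    using scale_invariant_singular_pairs unfolding scale_invariant_def by blast
  note cards = card_primitive_elliptic_pairs[OF char n] card_primitive_singular_pairs[OF char n]
    card_primitive_pairs_zero_fst[where ?'a = 'a, OF n] card_primitive_pairs_zero_snd[where ?'a = 'a, OF n]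
  note cards' = cards[folded q_def, folded Q_def, folded \<beta>_def \<gamma>_def]
  note counts = counts_of_primitive_pairs[OF char, folded q_def, folded Q_def]
  note inter = primitive_pairs_zero_families_inter[OF char, of n]
  have quot: "(Q - 1) * x / (Q - 1) = x" "(k * ((Q - 1) * x)) / (Q - 1) = k * x" for k x
    using Q1 by simp_all
  show "weighted_count (curves_of (primitive_pairs (- singular_pairs :: ('a poly \<times> 'a poly) set) n)) =
      coeff_a q * Q ^ (10 * n) - Q ^ (2 * n)"
    unfolding counts(1)[OF compl] cards' quot ..
  show "weighted_count (curves_of (primitive_pairs (singular_pairs :: ('a poly \<times> 'a poly) set) n)) =
      Q ^ (2 * n) + 1"
    unfolding counts(1)[OF scale_invariant_singular_pairs] cards' quot ..
  show "weighted_count (curves_of (primitive_pairs {p :: 'a poly \<times> 'a poly. fst p = 0} n)) =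
      \<beta> * Q ^ (6 * n) + 1"
    unfolding counts(1)[OF scale_invariant_zero_fst] cards' quot ..
  show "weighted_count (curves_of (primitive_pairs {p :: 'a poly \<times> 'a poly. snd p = 0} n)) =
      \<gamma> * Q ^ (4 * n) + 1"
    unfolding counts(1)[OF scale_invariant_zero_snd] cards' quot ..
  show "real (unweighted_count (curves_of (primitive_pairs (- singular_pairs :: ('a poly \<times> 'a poly) set) n))) =
      2 * (coeff_a q * Q ^ (10 * n) - Q ^ (2 * n))
      + 4 * delta 6 q * (\<beta> * Q ^ (6 * n) + 1) + 2 * delta 4 q * (\<gamma> * Q ^ (4 * n) + 1)"
    unfolding counts(2)[OF compl] inter cards' add_divide_distrib quot ..
  show "real (unweighted_count (curves_of (primitive_pairs (singular_pairs :: ('a poly \<times> 'a poly) set) n))) =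
      2 * (Q ^ (2 * n) + 1)"
    unfolding counts(2)[OF scale_invariant_singular_pairs] inter cards' add_divide_distrib quot by simp
  show "real (unweighted_count (curves_of (primitive_pairs {p :: 'a poly \<times> 'a poly. fst p = 0} n))) =
      (2 + 4 * delta 6 q) * (\<beta> * Q ^ (6 * n) + 1)"
    unfolding counts(2)[OF scale_invariant_zero_fst] inter Int_absorb cards' add_divide_distrib quot
    by (simp add: algebra_simps)
  show "real (unweighted_count (curves_of (primitive_pairs {p :: 'a poly \<times> 'a poly. snd p = 0} n))) =
      (2 + 2 * delta 4 q) * (\<gamma> * Q ^ (4 * n) + 1)"
    unfolding counts(2)[OF scale_invariant_zero_snd] inter Int_absorb cards' add_divide_distrib quot
    by (simp add: algebra_simps)
qed

theorem theorem1p1: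
  fixes n q :: nat and B :: real
  assumes "q = CARD('a::{field,finite})"
    and "CHAR('a) > 3"
    and "n \<ge> 1"
    and "B = real q ^ (12 * n)"
  shows
    "weighted_count (elliptic_upto B :: 'a poly fract weierstrass set)
       = coeff_a q * B powr (5/6) - B powr (1/6)
     \<and> real (unweighted_count (elliptic_upto B :: 'a poly fract weierstrass set))
       = 2 * coeff_a q * B powr (5/6) + 4 * coeff_b q * B powr (1/2)
         + 2 * coeff_c q * B powr (1/3) - 2 * B powr (1/6) + coeff_d q
     \<and> coeff_a q \<ge> 0 \<and> coeff_b q \<ge> 0 \<and> coeff_c q \<ge> 0 \<and> coeff_d q \<ge> 0
     \<and> real (unweighted_count (elliptic_upto_with_j (0 :: 'a poly fract) B))
         - 2 * weighted_count (elliptic_upto_with_j (0 :: 'a poly fract) B)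
       = 4 * coeff_b q * B powr (1/2) + 4 * delta 6 q
     \<and> real (unweighted_count (elliptic_upto_with_j (1728 :: 'a poly fract) B))
         - 2 * weighted_count (elliptic_upto_with_j (1728 :: 'a poly fract) B)
       = 2 * coeff_c q * B powr (1/3) + 2 * delta 4 q
     \<and> weighted_count (singular_upto B :: 'a poly fract weierstrass set) = B powr (1/6) + 1
     \<and> real (unweighted_count (singular_upto B :: 'a poly fract weierstrass set))
       = 2 * B powr (1/6) + 2"
proof -
  note char = card_CHAR_gt_3[OF assms(2)]
  define Q where "Q = real q"
  have Q: "Q \<ge> 2" using CARD_field_ge_2[where ?'a = 'a] unfolding Q_def assms(1) by simp
  have B: "B = real (CARD('a) ^ (12 * n))" using assms(1,4) by simp
  \<comment> \<open>\<open>B = q\<^bsup>12 n\<^esup>\<close>, so the exponents 5/6, 1/2, 1/3, 1/6 are \<open>k / 12\<close> for \<open>k = 10, 6, 4, 2\<close>.\<close>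
  have powr: "B powr (real k / 12) = Q ^ (k * n)" for k
  proof -
    have "B powr (real k / 12) = (Q powr real (12 * n)) powr (real k / 12)"
      unfolding assms(4) Q_def[symmetric] using Q by (simp add: powr_realpow del: of_nat_mult)
    also have "\<dots> = Q powr real (k * n)" by (simp add: powr_powr mult.commute)
    also have "\<dots> = Q ^ (k * n)" using Q by (subst powr_realpow) auto
    finally show ?thesis .
  qed
  have powrs: "B powr (5/6) = Q ^ (10 * n)" "B powr (1/2) = Q ^ (6 * n)"
    "B powr (1/3) = Q ^ (4 * n)" "B powr (1/6) = Q ^ (2 * n)"
    using powr[of 10] powr[of 6] powr[of 4] powr[of 2] by simp_all
  define \<beta> where "\<beta> = (Q ^ 5 - 1) / (Q ^ 5 - Q ^ 4)"
  define \<gamma> where "\<gamma> = (Q ^ 3 - 1) / (Q ^ 3 - Q ^ 2)"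
  have coeffs: "coeff_b q = delta 6 q * \<beta>" "coeff_c q = delta 4 q * \<gamma>"
    unfolding coeff_b_def coeff_c_def \<beta>_def \<gamma>_def Q_def by simp_all
  have "(Q ^ i - 1) / (Q ^ j - Q ^ k) \<ge> 0" if "k \<le> j" for i j k
    using Q that by (intro divide_nonneg_nonneg) (auto intro: power_increasing simp: one_le_power)
  then have "coeff_a q \<ge> 0" "\<beta> \<ge> 0" "\<gamma> \<ge> 0"
    unfolding coeff_a_def \<beta>_def \<gamma>_def Q_def by simp_all
  moreover from this have "coeff_b q \<ge> 0" "coeff_c q \<ge> 0" "coeff_d q \<ge> 0"
    unfolding coeffs coeff_d_def by (simp_all add: delta_def)
  moreover note counts_of_families[OF char assms(3), folded assms(1), folded Q_def, folded \<beta>_def \<gamma>_def]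
  ultimately show ?thesis
    unfolding curves_upto_eq[OF char, of n, folded B] powrs coeffs coeff_d_def
    by (simp add: algebra_simps)
qed

end
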